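(* Suppose that for every regular uncountable cardinal $\kappa$ and every stationary set $S \subseteq \kappa$, $\diamondsuit(S)$ holds. Then for every graph $X$, if $\mathrm{col}(X)$ is infinite then $\mathrm{col}(X)=\mathrm{List}(X)$.
   Context: A graph is a pair $X=\langle V_X,\mathcal{E}_X\rangle$ with $\mathcal{E}_X\subseteq[V_X]^2$ (simple, undirected); $x\,\mathcal{E}\,y$ means $\{x,y\}\in\mathcal{E}$, and $\mathcal{E}^x=\{y: y\,\mathcal{E}\,x\}$. A good coloring of $X$ is $f:X\to\mathrm{ON}$ with $f(x)\neq f(y)$ whenever $x\,\mathcal{E}\,y$. A $\kappa$-assignment is a function $F:X\to[\mathrm{ON}]^\kappa$. The list-chromatic number $\mathrm{List}(X)$ is the least (finite or infinite) cardinal $\kappa$ such that for every $\kappa$-assignment $F$ there is a good coloring $f$ with $f(x)\in F(x)$ for all $x$. The coloring number $\mathrm{col}(X)$ is the least cardinal $\kappa$ such that $X$ admits a well-ordering $\triangleleft$ with $|\{y\in\mathcal{E}^x: y\triangleleft x\}|<\kappa$ for every $x\in X$. For a regular uncountable $\kappa$ and stationary $S\subseteq\kappa$, $\diamondsuit(S)$ means there is a sequence $\langle d_\alpha:\alpha\in S\rangle$ with $d_\alpha \subseteq \alpha$ such that for every $A\subseteq\kappa$ the set $\{\alpha\in S: d_\alpha=A\cap\alpha\}$ is stationary. *)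

theory Defs
  imports "HOL-Library.Ramsey"
begin

unbundle cardinal_syntax

text \<open>
  Cardinals are represented as in the BNF cardinal library, by relations \<^term>\<open>\<kappa>\<close> with
  \<^prop>\<open>Card_order \<kappa>\<close>, and are compared with \<open>=o\<close>, \<open>\<le>o\<close>, \<open><o\<close>.  An
  ordinal below \<^term>\<open>\<kappa>\<close> is an element \<^term>\<open>\<alpha>\<close> of \<^term>\<open>Field \<kappa>\<close>; viewed
  as a set of ordinals it is \<^term>\<open>underS \<kappa> \<alpha>\<close>, the set of its strict predecessors.
\<close>

section \<open>Graphs, coloring number and list-chromatic number\<close>

definition graph :: "'a set \<Rightarrow> 'a set set \<Rightarrow> bool" where
  "graph V E \<longleftrightarrow> E \<subseteq> [V]\<^bsup>2\<^esup>"

definition nbrs :: "'a set set \<Rightarrow> 'a \<Rightarrow> 'a set" where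
  "nbrs E x = {y. {y, x} \<in> E}"

definition good_coloring :: "'a set \<Rightarrow> 'a set set \<Rightarrow> ('a \<Rightarrow> 'c) \<Rightarrow> bool" where
  "good_coloring V E f \<longleftrightarrow> (\<forall>x\<in>V. \<forall>y\<in>V. {x, y} \<in> E \<longrightarrow> f x \<noteq> f y)"

definition card_assignment :: "'a set \<Rightarrow> 'c set \<Rightarrow> 'k rel \<Rightarrow> ('a \<Rightarrow> 'c set) \<Rightarrow> bool" where
  "card_assignment V C \<kappa> F \<longleftrightarrow> (\<forall>x\<in>V. F x \<subseteq> C \<and> |F x| =o \<kappa>)"

definition list_colorable :: "'a set \<Rightarrow> 'a set set \<Rightarrow> 'c set \<Rightarrow> 'k rel \<Rightarrow> bool" where
  "list_colorable V E C \<kappa> \<longleftrightarrow>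
     (\<forall>F. card_assignment V C \<kappa> F \<longrightarrow> (\<exists>f. good_coloring V E f \<and> (\<forall>x\<in>V. f x \<in> F x)))"

definition well_orderable_below :: "'a set \<Rightarrow> 'a set set \<Rightarrow> 'k rel \<Rightarrow> bool" where
  "well_orderable_below V E \<kappa> \<longleftrightarrow>
     (\<exists>r. well_order_on V r \<and> (\<forall>x\<in>V. |nbrs E x \<inter> underS r x| <o \<kappa>))"

definition least_cardinal :: "('a rel \<Rightarrow> bool) \<Rightarrow> 'a rel" where
  "least_cardinal P =
     (SOME \<kappa>. Card_order \<kappa> \<and> P \<kappa> \<and> (\<forall>\<kappa>'. Card_order \<kappa>' \<and> P \<kappa>' \<longrightarrow> \<kappa> \<le>o \<kappa>'))"

text \<open>
  In both definitions below the least cardinal exists and is at most \<^term>\<open>|V|\<close>, so it can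
  be sought among the cardinals on the vertex type; the lemmas \<open>coloring_number\<close> and
  \<open>list_chromatic_number\<close> show that it is least among cardinals on any type.  The class of
  all ordinals, which serves as the supply of colors, is replaced by the type
  \<^typ>\<open>'a + nat\<close>.  The lemma \<open>list_colorable_any_colors\<close> shows that this type is large
  enough: being able to color from lists in it implies the same for lists in any set of colors
  of any type.
\<close>

definition coloring_number :: "'a set \<Rightarrow> 'a set set \<Rightarrow> 'a rel" where
  "coloring_number V E = least_cardinal (well_orderable_below V E)"

definition list_chromatic_number :: "'a set \<Rightarrow> 'a set set \<Rightarrow> 'a rel" where
  "list_chromatic_number V E = least_cardinal (list_colorable V E (UNIV :: ('a + nat) set))"


section \<open>Stationary sets and the diamond principle\<close>

definition regular_uncountable :: "'a rel \<Rightarrow> bool" where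
  "regular_uncountable \<kappa> \<longleftrightarrow> Card_order \<kappa> \<and> regularCard \<kappa> \<and> natLeq <o \<kappa>"

text \<open>
  Quantifying over all \<^term>\<open>\<kappa> :: 'a rel\<close> with this property amounts to quantifying
  over all regular uncountable cardinals up to the cardinality of the type \<^typ>\<open>'a\<close>.

  The second condition on \<^term>\<open>\<delta>\<close> in the definition of closedness says that
  \<^term>\<open>C\<close> is unbounded in \<^term>\<open>\<delta>\<close>; together with the first one it forces
  \<^term>\<open>\<delta>\<close> to be a limit.
\<close>

definition club :: "'a rel \<Rightarrow> 'a set \<Rightarrow> bool" where
  "club \<kappa> C \<longleftrightarrow> C \<subseteq> Field \<kappa> \<and> cofinal C \<kappa> \<and>
     (\<forall>\<delta>\<in>Field \<kappa>. underS \<kappa> \<delta> \<noteq> {} \<and>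
        (\<forall>\<beta>\<in>underS \<kappa> \<delta>. \<exists>\<gamma>\<in>C \<inter> underS \<kappa> \<delta>. \<beta> \<in> underS \<kappa> \<gamma>) \<longrightarrow> \<delta> \<in> C)"

definition stationary :: "'a rel \<Rightarrow> 'a set \<Rightarrow> bool" where
  "stationary \<kappa> S \<longleftrightarrow> S \<subseteq> Field \<kappa> \<and> (\<forall>C. club \<kappa> C \<longrightarrow> S \<inter> C \<noteq> {})"

definition diamond :: "'a rel \<Rightarrow> 'a set \<Rightarrow> bool" where
  "diamond \<kappa> S \<longleftrightarrow>
     (\<exists>d. (\<forall>\<alpha>\<in>S. d \<alpha> \<subseteq> underS \<kappa> \<alpha>) \<and>
          (\<forall>A\<subseteq>Field \<kappa>. stationary \<kappa> {\<alpha>\<in>S. d \<alpha> = A \<inter> underS \<kappa> \<alpha>}))"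


section \<open>Adequacy of the definitions\<close>

lemma well_orderable_below_card:
  fixes V :: "'a set" and \<kappa> :: "'k rel"
  assumes "|V| \<le>o \<kappa>"
  shows "well_orderable_below V E \<kappa>"
proof -
  have c: "Card_order |V|" and F: "Field |V| = V" by (rule card_of_Card_order, rule Field_card_of)
  have w: "well_order_on V |V|"
    using card_of_well_order_on by blast
  have "|nbrs E x \<inter> underS |V| x| <o \<kappa>" if "x \<in> V" for x
  proof -
    have "|nbrs E x \<inter> underS |V| x| \<le>o |underS |V| x|" by (rule card_of_mono1) auto
    also have "|underS |V| x| <o |V|" using card_of_underS[OF c] that F by auto
    finally show ?thesis using assms ordLess_ordLeq_trans by blast
  qed
  then show ?thesis unfolding well_orderable_below_def using w by blast
qed

text \<open>Greedy coloring along the well-ordering.\<close>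

lemma list_colorable_if_well_orderable_below:
  fixes V :: "'a set" and \<kappa> :: "'k rel" and C :: "'c set"
  assumes g: "graph V E" and wo: "well_orderable_below V E \<kappa>"
  shows "list_colorable V E C \<kappa>"
  unfolding list_colorable_def
proof (intro allI impI)
  fix F :: "'a \<Rightarrow> 'c set"
  assume F: "card_assignment V C \<kappa> F"
  from wo obtain r where r: "well_order_on V r"
    and lt: "\<And>x. x \<in> V \<Longrightarrow> |nbrs E x \<inter> underS r x| <o \<kappa>"
    unfolding well_orderable_below_def by blast
  have wf: "wf (r - Id)" using r by (simp add: well_order_on_def)
  define H where
    "H = (\<lambda>f x. SOME c. c \<in> F x \<and> c \<notin> f ` (nbrs E x \<inter> underS r x))"
  define f where "f = wfrec (r - Id) H"
  have feq: "f x = H f x" for x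
  proof -
    have "f x = H (cut f (r - Id) x) x" unfolding f_def by (rule wfrec[OF wf])
    also have "\<dots> = H f x"
    proof -
      have "cut f (r - Id) x ` (nbrs E x \<inter> underS r x) = f ` (nbrs E x \<inter> underS r x)"
        by (rule image_cong) (auto simp: cut_def underS_def)
      then show ?thesis unfolding H_def by simp
    qed
    finally show ?thesis .
  qed
  have f: "f x \<in> F x \<and> f x \<notin> f ` (nbrs E x \<inter> underS r x)" if x: "x \<in> V" for x
  proof -
    have "|f ` (nbrs E x \<inter> underS r x)| \<le>o |nbrs E x \<inter> underS r x|" by (rule card_of_image)
    also have "|nbrs E x \<inter> underS r x| <o \<kappa>" by (rule lt[OF x])
    also have "\<kappa> =o |F x|" using F x unfolding card_assignment_def
      by (auto intro: ordIso_symmetric)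
    finally have l: "|f ` (nbrs E x \<inter> underS r x)| <o |F x|" .
    have "\<not> F x \<subseteq> f ` (nbrs E x \<inter> underS r x)"
      using l card_of_mono1 not_ordLess_ordLeq by blast
    then have "\<exists>c. c \<in> F x \<and> c \<notin> f ` (nbrs E x \<inter> underS r x)" by blast
    then show ?thesis unfolding feq[of x] H_def by (rule someI_ex)
  qed
  have "good_coloring V E f"
    unfolding good_coloring_def
  proof (intro ballI impI)
    fix x y assume xy: "x \<in> V" "y \<in> V" "{x, y} \<in> E"
    then have ne: "x \<noteq> y" using g by (auto simp: graph_def nsets_def)
    have "(x, y) \<in> r \<or> (y, x) \<in> r"
      using r xy ne
      unfolding well_order_on_def linear_order_on_def total_on_def by blast
    then have "x \<in> nbrs E y \<inter> underS r y \<or> y \<in> nbrs E x \<inter> underS r x"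
      using ne xy by (auto simp: nbrs_def underS_def insert_commute)
    then show "f x \<noteq> f y" using f[OF xy(1)] f[OF xy(2)] by (metis image_eqI)
  qed
  then show "\<exists>f. good_coloring V E f \<and> (\<forall>x\<in>V. f x \<in> F x)" using f by blast
qed

lemma list_colorable_any_colors:
  fixes V :: "'a set" and \<kappa> :: "'k rel" and C :: "'c set"
  assumes g: "graph V E" and c: "Card_order \<kappa>"
    and lc: "list_colorable V E (UNIV :: ('a + nat) set) \<kappa>"
  shows "list_colorable V E C \<kappa>"
proof (cases "\<kappa> \<le>o |UNIV :: ('a + nat) set|")
  case True
  show ?thesis
    unfolding list_colorable_def
  proof (intro allI impI)
    fix F :: "'a \<Rightarrow> 'c set"
    assume F: "card_assignment V C \<kappa> F"
    let ?U = "UNIV :: ('a + nat) set"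
    have inf: "\<not> finite ?U" by simp
    have "|\<Union>x\<in>V. F x| \<le>o |?U|"
    proof (rule card_of_UNION_ordLeq_infinite[OF inf])
      show "|V| \<le>o |?U|"
        unfolding card_of_ordLeq[symmetric] by (rule exI[of _ Inl]) auto
      show "\<forall>x\<in>V. |F x| \<le>o |?U|"
        using F True unfolding card_assignment_def by (blast intro: ordIso_ordLeq_trans)
    qed
    then obtain h :: "'c \<Rightarrow> 'a + nat" where h: "inj_on h (\<Union>x\<in>V. F x)"
      unfolding card_of_ordLeq[symmetric] by iprover
    define F' :: "'a \<Rightarrow> ('a + nat) set" where "F' = (\<lambda>x. h ` F x)"
    have "|F' x| =o \<kappa>" if "x \<in> V" for x
    proof -
      have "inj_on h (F x)" using h that by (auto intro: inj_on_subset)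
      then have "bij_betw h (F x) (F' x)" unfolding F'_def by (rule inj_on_imp_bij_betw)
      then have "|F x| =o |F' x|" by (rule card_of_ordIsoI)
      moreover have "|F x| =o \<kappa>" using F that by (auto simp: card_assignment_def)
      ultimately show ?thesis by (rule ordIso_transitive[OF ordIso_symmetric])
    qed
    then have "card_assignment V ?U \<kappa> F'" by (simp add: card_assignment_def)
    then obtain f' where f': "good_coloring V E f'" "\<And>x. x \<in> V \<Longrightarrow> f' x \<in> F' x"
      using lc unfolding list_colorable_def by blast
    then have "\<forall>x\<in>V. \<exists>c\<in>F x. h c = f' x" by (fastforce simp: F'_def)
    then obtain f where f: "\<And>x. x \<in> V \<Longrightarrow> f x \<in> F x \<and> h (f x) = f' x" by metis
    have "good_coloring V E f"
      using f'(1) f unfolding good_coloring_def by metis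
    then show "\<exists>f. good_coloring V E f \<and> (\<forall>x\<in>V. f x \<in> F x)" using f by blast
  qed
next
  case False
  have "|V| \<le>o |UNIV :: ('a + nat) set|"
    unfolding card_of_ordLeq[symmetric] by (rule exI[of _ Inl]) auto
  moreover have "|UNIV :: ('a + nat) set| \<le>o \<kappa>"
    using False c ordLeq_total[OF card_of_Well_order[of "UNIV :: ('a + nat) set"]]
    unfolding card_order_on_def by blast
  ultimately have "|V| \<le>o \<kappa>" using ordLeq_transitive by blast
  then show ?thesis
    by (intro list_colorable_if_well_orderable_below[OF g] well_orderable_below_card)
qed

lemma well_orderable_below_cong:
  "\<kappa> =o \<kappa>' \<Longrightarrow> well_orderable_below V E \<kappa> \<Longrightarrow> well_orderable_below V E \<kappa>'"
  unfolding well_orderable_below_def using ordLess_ordIso_trans[of _ \<kappa> \<kappa>'] by blast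

lemma list_colorable_cong:
  "\<kappa> =o \<kappa>' \<Longrightarrow> list_colorable V E C \<kappa> \<Longrightarrow> list_colorable V E C \<kappa>'"
  unfolding list_colorable_def card_assignment_def
  using ordIso_transitive[OF _ ordIso_symmetric[of \<kappa> \<kappa>']] by blast

lemma least_cardinal:
  fixes P :: "'a rel \<Rightarrow> bool"
  assumes "Card_order \<kappa>" "P \<kappa>"
  shows "Card_order (least_cardinal P)" "P (least_cardinal P)" "least_cardinal P \<le>o \<kappa>"
proof -
  have "\<exists>r\<in>{\<kappa>. Card_order \<kappa> \<and> P \<kappa>}. \<forall>r'\<in>{\<kappa>. Card_order \<kappa> \<and> P \<kappa>}. r \<le>o r'"
    by (rule exists_minim_Card_order) (use assms in auto)
  then have "\<exists>\<kappa>. Card_order \<kappa> \<and> P \<kappa> \<and> (\<forall>\<kappa>'. Card_order \<kappa>' \<and> P \<kappa>' \<longrightarrow> \<kappa> \<le>o \<kappa>')" by blast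
  from someI_ex[OF this]
  have "Card_order (least_cardinal P) \<and> P (least_cardinal P) \<and>
        (\<forall>\<kappa>'. Card_order \<kappa>' \<and> P \<kappa>' \<longrightarrow> least_cardinal P \<le>o \<kappa>')"
    unfolding least_cardinal_def .
  then show "Card_order (least_cardinal P)" "P (least_cardinal P)" "least_cardinal P \<le>o \<kappa>"
    using assms by auto
qed

lemma cardinal_on_vertex_type:
  fixes V :: "'a set" and \<kappa> :: "'k rel"
  assumes "Card_order \<kappa>"
  obtains A :: "'a set" where "\<kappa> =o |A|" | "|V| \<le>o \<kappa>"
proof (cases "\<kappa> \<le>o |V|")
  case True
  then have "|Field \<kappa>| \<le>o |V|" by (rule ordIso_ordLeq_trans[OF card_of_Field_ordIso[OF assms]])
  then obtain h where h: "inj_on h (Field \<kappa>)" "h ` Field \<kappa> \<subseteq> V"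
    unfolding card_of_ordLeq[symmetric] by blast
  have "|Field \<kappa>| =o |h ` Field \<kappa>|"
    using h(1) inj_on_imp_bij_betw card_of_ordIsoI by blast
  then have "\<kappa> =o |h ` Field \<kappa>|"
    by (rule ordIso_transitive[OF ordIso_symmetric[OF card_of_Field_ordIso[OF assms]]])
  then show ?thesis by (rule that(1))
next
  case False
  then have "|V| \<le>o \<kappa>"
    using assms ordLeq_total[OF card_of_Well_order[of V]] unfolding card_order_on_def by blast
  then show ?thesis by (rule that(2))
qed

lemma coloring_number:
  fixes V :: "'a set"
  shows "Card_order (coloring_number V E)"
    and "well_orderable_below V E (coloring_number V E)"
    and "\<And>\<kappa> :: 'k rel. Card_order \<kappa> \<Longrightarrow> well_orderable_below V E \<kappa> \<Longrightarrow> coloring_number V E \<le>o \<kappa>"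
proof -
  have wV: "well_orderable_below V E |V|"
    by (rule well_orderable_below_card[OF card_of_mono1[OF subset_refl]])
  note c = card_of_Card_order[of V] wV
  note lc = least_cardinal[of _ "well_orderable_below V E"]
  show "Card_order (coloring_number V E)" "well_orderable_below V E (coloring_number V E)"
    unfolding coloring_number_def using lc(1,2)[OF c] by auto
  fix \<kappa> :: "'k rel" assume k: "Card_order \<kappa>" "well_orderable_below V E \<kappa>"
  show "coloring_number V E \<le>o \<kappa>"
  proof (cases rule: cardinal_on_vertex_type[OF k(1), where V = V])
    case (1 A)
    have "coloring_number V E \<le>o |A|"
      unfolding coloring_number_def
      using lc(3)[OF card_of_Card_order well_orderable_below_cong[OF 1 k(2)]] .
    then show ?thesis by (rule ordLeq_ordIso_trans[OF _ ordIso_symmetric[OF 1]])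
  next
    case 2
    have "coloring_number V E \<le>o |V|" unfolding coloring_number_def by (rule lc(3)[OF c])
    then show ?thesis using 2 by (rule ordLeq_transitive)
  qed
qed

lemma list_chromatic_number:
  fixes V :: "'a set"
  assumes g: "graph V E"
  shows "Card_order (list_chromatic_number V E)"
    and "list_colorable V E (C :: 'c set) (list_chromatic_number V E)"
    and "\<And>\<kappa> :: 'k rel. Card_order \<kappa> \<Longrightarrow> list_colorable V E (UNIV :: ('a + nat) set) \<kappa> \<Longrightarrow>
           list_chromatic_number V E \<le>o \<kappa>"
proof -
  let ?P = "list_colorable V E (UNIV :: ('a + nat) set)"
  have PV: "?P |V|"
    by (rule list_colorable_if_well_orderable_below[OF g
        well_orderable_below_card[OF card_of_mono1[OF subset_refl]]])
  note c = card_of_Card_order[of V] PV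
  note lc = least_cardinal[of _ ?P]
  show co: "Card_order (list_chromatic_number V E)"
    unfolding list_chromatic_number_def using lc(1)[OF c] .
  have "?P (list_chromatic_number V E)"
    unfolding list_chromatic_number_def using lc(2)[OF c] .
  then show "list_colorable V E C (list_chromatic_number V E)"
    by (rule list_colorable_any_colors[OF g co])
  fix \<kappa> :: "'k rel" assume k: "Card_order \<kappa>" "list_colorable V E (UNIV :: ('a + nat) set) \<kappa>"
  show "list_chromatic_number V E \<le>o \<kappa>"
  proof (cases rule: cardinal_on_vertex_type[OF k(1), where V = V])
    case (1 A)
    have "list_chromatic_number V E \<le>o |A|"
      unfolding list_chromatic_number_def
      using lc(3)[OF card_of_Card_order list_colorable_cong[OF 1 k(2)]] .
    then show ?thesis by (rule ordLeq_ordIso_trans[OF _ ordIso_symmetric[OF 1]])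
  next
    case 2
    have "list_chromatic_number V E \<le>o |V|"
      unfolding list_chromatic_number_def by (rule lc(3)[OF c])
    then show ?thesis using 2 by (rule ordLeq_transitive)
  qed
qed

end

theory Submission
  imports Defs Complex_Main
begin

text \<open>
  Coloring greedily along a well-ordering gives one inequality, and a list-colorability
  hypothesis for a cardinal \<open>\<mu>\<close> has to be turned into a well-ordering in which every vertex
  has fewer than \<open>\<mu>\<close> smaller neighbors.

  For infinite \<open>\<mu>\<close> this goes by induction on the number of vertices.  If the number of vertices
  is a regular cardinal above \<open>\<mu>\<close>, identify the vertices with ordinals and consider the
  \<open>\<alpha>\<close> for which some vertex not below \<open>\<alpha>\<close> has at least \<open>\<mu>\<close>
  neighbors below \<open>\<alpha>\<close>.  If these \<open>\<alpha>\<close> are not stationary, a club avoiding them cuts the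
  graph into smaller pieces.  If they are, choose a stationary set of such \<open>\<alpha>\<close> so that the
  vertices witnessing it still have \<open>\<mu>\<close> neighbors below \<open>\<alpha>\<close> that are not themselves witnesses.
  Give disjoint lists to all non-witnesses, guess the coloring of these by diamond, and
  let the list of a witness consist of the colors guessed on \<open>\<mu>\<close> of its neighbors.
  If the number of vertices is singular, a set of at least \<open>\<mu>\<^sup>+\<close> vertices can be enlarged, without
  changing its size, so that every outside vertex has fewer than \<open>\<mu>\<close> neighbors in it, and
  a continuous chain of such sets is obtained by iterating \<open>\<mu>\<^sup>+\<close> times.

  A finite list-chromatic number is impossible.  By Alon's random lists it would bound the
  minimum degree of all finite subgraphs, and a predimension argument turns this into a bound on the
  coloring number of the whole graph.
\<close>

section \<open>Well-orders\<close>

text \<open>Least elements of two-element sets give totality, and least elements in general give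
  well-foundedness of the strict part.\<close>

lemma well_order_onI:
  assumes "r \<subseteq> V \<times> V" "\<And>x. x \<in> V \<Longrightarrow> (x, x) \<in> r"
    "\<And>x y z. (x, y) \<in> r \<Longrightarrow> (y, z) \<in> r \<Longrightarrow> (x, z) \<in> r"
    "\<And>x y. (x, y) \<in> r \<Longrightarrow> (y, x) \<in> r \<Longrightarrow> x = y"
    "\<And>A. A \<subseteq> V \<Longrightarrow> A \<noteq> {} \<Longrightarrow> \<exists>m\<in>A. \<forall>a\<in>A. (m, a) \<in> r"
  shows "well_order_on V r"
proof -
  have tot: "(x, y) \<in> r \<or> (y, x) \<in> r" if "x \<in> V" "y \<in> V" for x y
    using assms(5)[of "{x, y}"] that by auto
  have "wf (r - Id)"
  proof (rule wfI_min)
    fix x :: 'a and Q assume "x \<in> Q"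
    show "\<exists>z\<in>Q. \<forall>y. (y, z) \<in> r - Id \<longrightarrow> y \<notin> Q"
    proof (cases "Q \<inter> V = {}")
      case True then show ?thesis using \<open>x \<in> Q\<close> assms(1) by blast
    next
      case False
      with assms(5)[of "Q \<inter> V"] obtain m where m: "m \<in> Q \<inter> V" "\<forall>a\<in>Q \<inter> V. (m, a) \<in> r" by blast
      then show ?thesis using assms(1,4) by (intro bexI[of _ m]) auto
    qed
  qed
  then show ?thesis using assms(1-4) tot
    unfolding order_on_defs refl_on_def trans_def antisym_def total_on_def by blast
qed

lemma well_order_onD:
  assumes "well_order_on V r"
  shows "(x, y) \<in> r \<Longrightarrow> x \<in> V \<and> y \<in> V" "x \<in> V \<Longrightarrow> (x, x) \<in> r"
    "(x, y) \<in> r \<Longrightarrow> (y, z) \<in> r \<Longrightarrow> (x, z) \<in> r"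
    "(x, y) \<in> r \<Longrightarrow> (y, x) \<in> r \<Longrightarrow> x = y"
    "x \<in> V \<Longrightarrow> y \<in> V \<Longrightarrow> (x, y) \<in> r \<or> (y, x) \<in> r"
proof -
  have r: "r \<subseteq> V \<times> V" "refl_on V r" "trans r" "antisym r" "total_on V r"
    using assms by (auto simp: order_on_defs)
  show "(x, y) \<in> r \<Longrightarrow> x \<in> V \<and> y \<in> V" using r(1) by blast
  show "x \<in> V \<Longrightarrow> (x, x) \<in> r" using r(2) by (simp add: refl_on_def)
  show "(x, y) \<in> r \<Longrightarrow> (y, z) \<in> r \<Longrightarrow> (x, z) \<in> r" using r(3) by (rule transD)
  show "(x, y) \<in> r \<Longrightarrow> (y, x) \<in> r \<Longrightarrow> x = y" using r(4) by (rule antisymD)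
  show "x \<in> V \<Longrightarrow> y \<in> V \<Longrightarrow> (x, y) \<in> r \<or> (y, x) \<in> r"
    using r(2,5) unfolding total_on_def refl_on_def by (cases "x = y") auto
qed

lemma well_order_on_least:
  assumes w: "well_order_on V r" and "A \<subseteq> V" "A \<noteq> {}"
  obtains m where "m \<in> A" "\<And>a. a \<in> A \<Longrightarrow> (m, a) \<in> r"
proof -
  have "wf (r - Id)" using w by (simp add: well_order_on_def)
  then obtain m where m: "m \<in> A" "\<And>y. (y, m) \<in> r - Id \<Longrightarrow> y \<notin> A"
    using assms(3) by (meson ex_in_conv wfE_min)
  have "(m, a) \<in> r" if "a \<in> A" for a
    using well_order_onD(2,5)[OF w] m that assms(2) by (metis DiffI pair_in_Id_conv subsetD)
  then show thesis using that m by blast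
qed

lemma underS_trans:
  assumes "well_order_on V r" "x \<in> underS r y" "(y, z) \<in> r \<or> y \<in> underS r z"
  shows "x \<in> underS r z"
  using assms(2,3) well_order_onD(3)[OF assms(1), of x y z] well_order_onD(4)[OF assms(1), of x y]
  unfolding underS_def by blast

lemma underS_trans2:
  assumes "well_order_on V r" "(x, y) \<in> r" "y \<in> underS r z"
  shows "x \<in> underS r z"
  using assms(2,3) well_order_onD(3)[OF assms(1), of x y z] well_order_onD(4)[OF assms(1), of x y]
  unfolding underS_def by blast

lemma not_in_underS_iff:
  assumes "well_order_on V r" "x \<in> V" "y \<in> V"
  shows "x \<notin> underS r y \<longleftrightarrow> (y, x) \<in> r"
  using well_order_onD(2)[OF assms(1,2)] well_order_onD(5)[OF assms]
    well_order_onD(4)[OF assms(1), of x y]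
  unfolding underS_def by blast

lemma Card_order_wo: "Card_order r \<Longrightarrow> well_order_on (Field r) r"
  by (simp add: card_order_on_def)

text \<open>This is the ordered sum of the fibres of \<open>k\<close>, placed one after another
  along \<open>s\<close>. The formula for \<open>underS\<close> lets the smaller neighbors be
  counted separately in earlier fibres and in the vertex's own fibre.\<close>

lemma well_order_lex:
  fixes k :: "'a \<Rightarrow> 'i"
  assumes s: "well_order_on I s" and k: "\<And>x. x \<in> V \<Longrightarrow> k x \<in> I"
    and \<rho>: "\<And>i. i \<in> I \<Longrightarrow> well_order_on {x\<in>V. k x = i} (\<rho> i)"
  obtains r where "well_order_on V r"
    "\<And>x. x \<in> V \<Longrightarrow> underS r x = {y\<in>V. k y \<in> underS s (k x)} \<union> underS (\<rho> (k x)) x"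
proof -
  define r where "r = {(x, y). x \<in> V \<and> y \<in> V \<and> (k x \<in> underS s (k y) \<or> k x = k y \<and> (x, y) \<in> \<rho> (k x))}"
  note sD = well_order_onD[OF s]
  note \<rho>D = well_order_onD[OF \<rho>]
  have wr: "well_order_on V r"
  proof (rule well_order_onI)
    show "r \<subseteq> V \<times> V" by (auto simp: r_def)
    show "(x, x) \<in> r" if "x \<in> V" for x using that k \<rho>D(2) by (auto simp: r_def)
    have \<rho>D': "(x, y) \<in> \<rho> (k u) \<Longrightarrow> (y, z) \<in> \<rho> (k u) \<Longrightarrow> (x, z) \<in> \<rho> (k u)"
      "(x, y) \<in> \<rho> (k u) \<Longrightarrow> (y, x) \<in> \<rho> (k u) \<Longrightarrow> x = y" if "u \<in> V" for u x y z
      using \<rho>D(3,4)[OF k[OF that]] by blast+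
    have sD': "i \<in> underS s j \<Longrightarrow> j \<in> underS s l \<Longrightarrow> i \<in> underS s l"
      "i \<in> underS s j \<Longrightarrow> j \<in> underS s i \<Longrightarrow> False" "i \<notin> underS s i" for i j l
      using sD(3,4) unfolding underS_def by blast+
    show "(x, z) \<in> r" if xy: "(x, y) \<in> r" and yz: "(y, z) \<in> r" for x y z
    proof -
      have V: "x \<in> V" "y \<in> V" "z \<in> V" using xy yz by (auto simp: r_def)
      consider "k x \<in> underS s (k y)" "k y \<in> underS s (k z)" | "k x \<in> underS s (k y)" "k y = k z"
        | "k x = k y" "k y \<in> underS s (k z)"
        | "k x = k y" "k y = k z" "(x, y) \<in> \<rho> (k x)" "(y, z) \<in> \<rho> (k x)"
        using xy yz unfolding r_def by auto
      then have "k x \<in> underS s (k z) \<or> k x = k z \<and> (x, z) \<in> \<rho> (k x)"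
        by cases (use sD'(1) \<rho>D'(1)[OF V(1)] in auto)
      then show ?thesis using V by (simp add: r_def)
    qed
    show "x = y" if xy: "(x, y) \<in> r" and yx: "(y, x) \<in> r" for x y
    proof -
      have "x \<in> V" using xy by (auto simp: r_def)
      moreover have "k x = k y" "(x, y) \<in> \<rho> (k x)" "(y, x) \<in> \<rho> (k x)"
        using xy yx sD'(2,3) unfolding r_def by auto
      ultimately show ?thesis using \<rho>D'(2) by blast
    qed
    show "\<exists>m\<in>A. \<forall>a\<in>A. (m, a) \<in> r" if A: "A \<subseteq> V" "A \<noteq> {}" for A
    proof -
      have "k ` A \<subseteq> I" "k ` A \<noteq> {}" using A k by auto
      then obtain i where i: "i \<in> k ` A" "\<And>j. j \<in> k ` A \<Longrightarrow> (i, j) \<in> s"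
        using well_order_on_least[OF s] by blast
      then have "i \<in> I" "{x\<in>A. k x = i} \<subseteq> {x\<in>V. k x = i}" "{x\<in>A. k x = i} \<noteq> {}"
        using \<open>k ` A \<subseteq> I\<close> A by auto
      then obtain m where m: "m \<in> {x\<in>A. k x = i}" "\<And>a. a \<in> {x\<in>A. k x = i} \<Longrightarrow> (m, a) \<in> \<rho> i"
        using well_order_on_least[OF \<rho>] by blast
      have "(m, a) \<in> r" if "a \<in> A" for a
        using i(2)[of "k a"] m that A by (auto simp: r_def underS_def)
      then show ?thesis using m by blast
    qed
  qed
  have "underS r x = {y\<in>V. k y \<in> underS s (k x)} \<union> underS (\<rho> (k x)) x" if x: "x \<in> V" for x
  proof -
    have ne: "k x \<notin> underS s (k x)" by (simp add: underS_def)
    have fib: "y \<in> V \<and> k y = k x" if "(y, x) \<in> \<rho> (k x)" for y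
      using \<rho>D(1)[OF k[OF x] that] by simp
    show ?thesis
    proof (intro set_eqI iffI)
      fix y assume "y \<in> underS r x"
      then show "y \<in> {y\<in>V. k y \<in> underS s (k x)} \<union> underS (\<rho> (k x)) x"
        unfolding r_def underS_def[of _ x] by auto
    next
      fix y assume "y \<in> {y\<in>V. k y \<in> underS s (k x)} \<union> underS (\<rho> (k x)) x"
      then consider "y \<in> V" "k y \<in> underS s (k x)" | "y \<noteq> x" "(y, x) \<in> \<rho> (k x)" "y \<in> V" "k y = k x"
        using fib unfolding underS_def[of _ x] by blast
      then show "y \<in> underS r x"
        by cases (use x ne in \<open>auto simp: r_def underS_def[of _ x]\<close>)
    qed
  qed
  with wr show thesis by (rule that)
qed

text \<open>As \<open>\<mu>\<close> is infinite, fewer than \<open>\<mu>\<close> neighbors in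
  earlier fibres and fewer than \<open>\<mu>\<close> smaller ones in the same fibre add up to fewer
  than \<open>\<mu>\<close>. The regular non-stationary case and the singular case both end with
  this decomposition.\<close>

lemma well_orderable_below_lex:
  fixes \<mu> :: "'m rel" and k :: "'a \<Rightarrow> 'i"
  assumes \<mu>: "Cinfinite \<mu>" and s: "well_order_on I s" and k: "\<And>x. x \<in> V \<Longrightarrow> k x \<in> I"
    and below: "\<And>x. x \<in> V \<Longrightarrow> |nbrs E x \<inter> {y\<in>V. k y \<in> underS s (k x)}| <o \<mu>"
    and fib: "\<And>i. i \<in> I \<Longrightarrow> well_orderable_below {x\<in>V. k x = i} E \<mu>"
  shows "well_orderable_below V E \<mu>"
proof -
  have "\<forall>i\<in>I. \<exists>\<rho>. well_order_on {x\<in>V. k x = i} \<rho> \<and>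
      (\<forall>x\<in>{x\<in>V. k x = i}. |nbrs E x \<inter> underS \<rho> x| <o \<mu>)"
    using fib unfolding well_orderable_below_def by (rule ballI)
  from bchoice[OF this] obtain \<rho> where \<rho>: "\<And>i. i \<in> I \<Longrightarrow> well_order_on {x\<in>V. k x = i} (\<rho> i)"
    "\<And>i x. i \<in> I \<Longrightarrow> x \<in> {x\<in>V. k x = i} \<Longrightarrow> |nbrs E x \<inter> underS (\<rho> i) x| <o \<mu>"
    by auto
  obtain r where r: "well_order_on V r"
    "\<And>x. x \<in> V \<Longrightarrow> underS r x = {y\<in>V. k y \<in> underS s (k x)} \<union> underS (\<rho> (k x)) x"
    by (rule well_order_lex[where I = I and s = s and k = k and V = V and \<rho> = \<rho>]) (use s k \<rho>(1) in auto)
  have "|nbrs E x \<inter> underS r x| <o \<mu>" if "x \<in> V" for x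
    unfolding r(2)[OF that] Int_Un_distrib
    by (rule Un_Cinfinite_bound_strict[OF below[OF that] \<rho>(2)[OF k[OF that]] \<mu>]) (use that in simp)
  then show ?thesis using r(1) unfolding well_orderable_below_def by blast
qed

section \<open>Finite list-chromatic numbers\<close>

text \<open>Each point of \<open>M\<close> lies in a fraction \<open>s / card M\<close> of the
  \<open>s\<close>-subsets of \<open>M\<close>, so by the union bound at most a fraction
  \<open>s * s / card M\<close> of them meets \<open>R\<close>. The denominator is multiplied
  out.\<close>

lemma card_sets_meeting:
  assumes "finite M" "R \<subseteq> M" "card R \<le> s"
  shows "card M * card {\<tau>. \<tau> \<subseteq> M \<and> card \<tau> = s \<and> \<tau> \<inter> R \<noteq> {}}
    \<le> s * s * card {\<tau>. \<tau> \<subseteq> M \<and> card \<tau> = s}"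
proof (cases s)
  case 0
  then have "{\<tau>. \<tau> \<subseteq> M \<and> card \<tau> = s \<and> \<tau> \<inter> R \<noteq> {}} = {}"
    using assms(1) by (auto dest: finite_subset simp: card_eq_0_iff)
  then show ?thesis by (metis card.empty mult_0_right zero_le)
next
  case (Suc s')
  have finR: "finite R" using assms finite_subset by blast
  have "{\<tau>. \<tau> \<subseteq> M \<and> card \<tau> = s \<and> \<tau> \<inter> R \<noteq> {}}
      \<subseteq> (\<Union>x\<in>R. insert x ` {\<sigma>. \<sigma> \<subseteq> M - {x} \<and> card \<sigma> = s'})"
  proof
    fix \<tau> assume "\<tau> \<in> {\<tau>. \<tau> \<subseteq> M \<and> card \<tau> = s \<and> \<tau> \<inter> R \<noteq> {}}"
    then obtain x where x: "x \<in> \<tau>" "x \<in> R" "\<tau> \<subseteq> M" "card \<tau> = s" by blast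
    then have "\<tau> = insert x (\<tau> - {x})" "\<tau> - {x} \<in> {\<sigma>. \<sigma> \<subseteq> M - {x} \<and> card \<sigma> = s'}"
      using Suc by auto
    then show "\<tau> \<in> (\<Union>x\<in>R. insert x ` {\<sigma>. \<sigma> \<subseteq> M - {x} \<and> card \<sigma> = s'})" using x(2) by blast
  qed
  then have "card {\<tau>. \<tau> \<subseteq> M \<and> card \<tau> = s \<and> \<tau> \<inter> R \<noteq> {}}
      \<le> card (\<Union>x\<in>R. insert x ` {\<sigma>. \<sigma> \<subseteq> M - {x} \<and> card \<sigma> = s'})"
    using assms(1) finR by (intro card_mono) auto
  also have "\<dots> \<le> (\<Sum>x\<in>R. card (insert x ` {\<sigma>. \<sigma> \<subseteq> M - {x} \<and> card \<sigma> = s'}))"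
    by (rule card_UN_le[OF finR])
  also have "\<dots> \<le> (\<Sum>x\<in>R. (card M - 1) choose s')"
  proof (rule sum_mono)
    fix x assume "x \<in> R"
    have "card (insert x ` {\<sigma>. \<sigma> \<subseteq> M - {x} \<and> card \<sigma> = s'}) \<le> card {\<sigma>. \<sigma> \<subseteq> M - {x} \<and> card \<sigma> = s'}"
      using assms(1) by (intro card_image_le) auto
    also have "\<dots> = (card M - 1) choose s'"
      using assms(1,2) \<open>x \<in> R\<close> by (subst n_subsets) auto
    finally show "card (insert x ` {\<sigma>. \<sigma> \<subseteq> M - {x} \<and> card \<sigma> = s'}) \<le> (card M - 1) choose s'" .
  qed
  also have "\<dots> \<le> s * ((card M - 1) choose s')" using assms(3) by simp
  finally have "card M * card {\<tau>. \<tau> \<subseteq> M \<and> card \<tau> = s \<and> \<tau> \<inter> R \<noteq> {}}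
      \<le> card M * (s * ((card M - 1) choose s'))"
    by (rule mult_le_mono2)
  also have "\<dots> = s * (card M * ((card M - 1) choose s'))" by simp
  also have "card M * ((card M - 1) choose s') = s * (card M choose s)"
    using Suc binomial_absorption[of s' "card M"] by simp
  also have "card M choose s = card {\<tau>. \<tau> \<subseteq> M \<and> card \<tau> = s}"
    using n_subsets[OF assms(1)] by simp
  finally show ?thesis by (simp add: mult.assoc)
qed

text \<open>For a random \<open>L\<close>, a fixed \<open>a\<close> misses a given value with
  probability at most \<open>(1 - 1/t) ^ D\<close>, hence misses some value with probability at most
  1/2 by the condition on \<open>D\<close>. Some \<open>L\<close> does at least as well as the
  average.\<close>

lemma exists_surjective_on_many:
  fixes N :: "'a \<Rightarrow> 'b set"
  assumes fin: "finite A" "finite B" "finite T" and t: "card T = t" "t > 0"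
    and D: "2 * t * (t - 1) ^ D \<le> t ^ D"
    and N: "\<And>a. a \<in> A \<Longrightarrow> N a \<subseteq> B \<and> D \<le> card (N a)"
  obtains L where "L \<in> B \<rightarrow>\<^sub>E T" "card A \<le> 2 * card {a\<in>A. T \<subseteq> L ` N a}"
proof -
  let ?\<Omega> = "B \<rightarrow>\<^sub>E T"
  have fin\<Omega>: "finite ?\<Omega>" and card\<Omega>: "card ?\<Omega> = t ^ card B"
    using fin t by (auto simp: finite_PiE card_PiE)
  have bad: "2 * card {L\<in>?\<Omega>. \<not> T \<subseteq> L ` N a} \<le> t ^ card B" if a: "a \<in> A" for a
  proof -
    let ?n = "card (N a)"
    have Na: "N a \<subseteq> B" "D \<le> ?n" using N[OF a] by auto
    have miss: "card {L\<in>?\<Omega>. \<tau> \<notin> L ` N a} = (t - 1) ^ ?n * t ^ (card B - ?n)" if "\<tau> \<in> T" for \<tau>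
    proof -
      have "{L\<in>?\<Omega>. \<tau> \<notin> L ` N a} = PiE B (\<lambda>b. if b \<in> N a then T - {\<tau>} else T)"
      proof (intro set_eqI iffI)
        fix L assume "L \<in> {L\<in>?\<Omega>. \<tau> \<notin> L ` N a}"
        then show "L \<in> PiE B (\<lambda>b. if b \<in> N a then T - {\<tau>} else T)" by (auto simp: PiE_iff)
      next
        fix L assume "L \<in> PiE B (\<lambda>b. if b \<in> N a then T - {\<tau>} else T)"
        then have L: "\<And>b. b \<in> B \<Longrightarrow> L b \<in> (if b \<in> N a then T - {\<tau>} else T)" "L \<in> extensional B"
          by (auto simp: PiE_iff)
        have "L b \<in> T" if "b \<in> B" for b using L(1)[OF that] by (auto split: if_splits)
        moreover have "L b \<noteq> \<tau>" if "b \<in> N a" for b using L(1)[of b] that Na by auto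
        ultimately show "L \<in> {L\<in>?\<Omega>. \<tau> \<notin> L ` N a}" using L(2) by (auto simp: PiE_iff)
      qed
      then have "card {L\<in>?\<Omega>. \<tau> \<notin> L ` N a} = (\<Prod>b\<in>B. card (if b \<in> N a then T - {\<tau>} else T))"
        using fin by (simp add: card_PiE)
      also have "\<dots> = (\<Prod>b\<in>B. if b \<in> N a then t - 1 else t)"
        using that t fin by (intro prod.cong) (auto simp: card_Diff_singleton)
      also have "\<dots> = (t - 1) ^ card (B \<inter> N a) * t ^ card (B \<inter> - N a)"
        using fin by (simp add: prod.If_cases)
      also have "B \<inter> N a = N a" using Na by blast
      also have "card (B \<inter> - N a) = card B - ?n"
        using Na fin by (metis card_Diff_subset finite_subset Diff_eq)
      finally show ?thesis .
    qed
    have "{L\<in>?\<Omega>. \<not> T \<subseteq> L ` N a} = (\<Union>\<tau>\<in>T. {L\<in>?\<Omega>. \<tau> \<notin> L ` N a})" by auto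
    then have "card {L\<in>?\<Omega>. \<not> T \<subseteq> L ` N a} \<le> (\<Sum>\<tau>\<in>T. card {L\<in>?\<Omega>. \<tau> \<notin> L ` N a})"
      by (simp add: card_UN_le[OF fin(3)])
    also have "\<dots> = t * ((t - 1) ^ ?n * t ^ (card B - ?n))" using miss t by simp
    finally have "2 * card {L\<in>?\<Omega>. \<not> T \<subseteq> L ` N a} \<le> (2 * t * (t - 1) ^ ?n) * t ^ (card B - ?n)"
      by simp
    also have "2 * t * (t - 1) ^ ?n \<le> t ^ ?n"
    proof -
      have n: "?n = D + (?n - D)" using Na by simp
      have "2 * t * (t - 1) ^ ?n = 2 * t * (t - 1) ^ D * (t - 1) ^ (?n - D)"
        by (subst n, simp add: power_add)
      also have "\<dots> \<le> t ^ D * t ^ (?n - D)" by (intro mult_le_mono D power_mono) auto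
      also have "\<dots> = t ^ ?n" by (subst (2) n, simp add: power_add)
      finally show ?thesis .
    qed
    then have "(2 * t * (t - 1) ^ ?n) * t ^ (card B - ?n) \<le> t ^ ?n * t ^ (card B - ?n)" by simp
    also have "\<dots> = t ^ card B"
      using card_mono[OF fin(2) Na(1)] by (simp flip: power_add)
    finally show ?thesis .
  qed
  have "\<exists>L\<in>?\<Omega>. 2 * card {a\<in>A. \<not> T \<subseteq> L ` N a} \<le> card A"
  proof (rule ccontr)
    assume "\<not> ?thesis"
    then have "\<And>L. L \<in> ?\<Omega> \<Longrightarrow> card A < 2 * card {a\<in>A. \<not> T \<subseteq> L ` N a}" by force
    then have "(\<Sum>L\<in>?\<Omega>. card A) < (\<Sum>L\<in>?\<Omega>. 2 * card {a\<in>A. \<not> T \<subseteq> L ` N a})"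
      using fin\<Omega> card\<Omega> t by (intro sum_strict_mono) (auto simp: card_gt_0_iff[symmetric])
    also have "\<dots> = 2 * (\<Sum>L\<in>?\<Omega>. card {a\<in>A. \<not> T \<subseteq> L ` N a})" by (simp add: sum_distrib_left)
    also have "(\<Sum>L\<in>?\<Omega>. card {a\<in>A. \<not> T \<subseteq> L ` N a}) = (\<Sum>a\<in>A. card {L\<in>?\<Omega>. \<not> T \<subseteq> L ` N a})"
      using sum_multicount_gen[OF fin\<Omega> fin(1), of "\<lambda>L a. \<not> T \<subseteq> L ` N a"]  by auto
    also have "2 * \<dots> = (\<Sum>a\<in>A. 2 * card {L\<in>?\<Omega>. \<not> T \<subseteq> L ` N a})" by (simp add: sum_distrib_left)
    also have "\<dots> \<le> (\<Sum>a\<in>A. t ^ card B)" by (intro sum_mono bad)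
    finally show False using card\<Omega> by simp
  qed
  then obtain L where L: "L \<in> ?\<Omega>" "2 * card {a\<in>A. \<not> T \<subseteq> L ` N a} \<le> card A" by blast
  have "card A = card {a\<in>A. T \<subseteq> L ` N a} + card {a\<in>A. \<not> T \<subseteq> L ` N a}"
    using fin(1) by (subst card_Un_disjoint[symmetric]) (auto intro: arg_cong[where f = card])
  with L show thesis by (intro that[of L]) auto
qed

lemma exists_pow_small:
  fixes t :: nat
  assumes "t > 0"
  shows "\<exists>D. 2 * t * (t - 1) ^ D \<le> t ^ D"
proof -
  define x where "x = real (t - 1) / real t"
  have "x < 1" using assms by (simp add: x_def)
  then obtain D where D: "x ^ D < 1 / (2 * real t)"
    using real_arch_pow_inv[of "1 / (2 * real t)" x] assms by auto
  have "real (t - 1) ^ D = x ^ D * real t ^ D" using assms by (simp add: x_def power_divide)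
  also have "\<dots> \<le> 1 / (2 * real t) * real t ^ D" using D by (intro mult_right_mono) auto
  finally have "2 * real t * real (t - 1) ^ D \<le> real t ^ D" using assms by (simp add: field_simps)
  then have "real (2 * t * (t - 1) ^ D) \<le> real (t ^ D)" by simp
  then show ?thesis by (intro exI[of _ D]) (simp only: of_nat_le_iff)
qed

text \<open>This is the form of list-colorability for finite lists in which lists can be counted by
  \<open>card\<close>; \<open>choosable_if_list_colorable\<close> derives it from the cardinal
  version.\<close>

definition choosable :: "'a set \<Rightarrow> 'a set set \<Rightarrow> nat \<Rightarrow> bool" where
  "choosable V E s \<longleftrightarrow>
     (\<forall>F :: 'a \<Rightarrow> nat set. (\<forall>x\<in>V. finite (F x) \<and> card (F x) = s) \<longrightarrow>
        (\<exists>f. good_coloring V E f \<and> (\<forall>x\<in>V. f x \<in> F x)))"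

text \<open>
  Alon's argument, by counting: all lists are \<open>s\<close>-subsets of \<open>M\<close>.  For a suitable choice of
  lists on \<open>B\<close>, at least half of \<open>A\<close> sees all possible lists, so that a coloring
  of \<open>B\<close> leaves such a vertex fewer than \<open>s\<close> colors.  As \<open>card M > s ^ 4\<close>, the lists on
  these vertices that are compatible with some of the at most \<open>s ^ card B\<close> colorings do not
  exhaust all lists.
\<close>

lemma choosable_expansion:
  assumes "choosable V E s"
  obtains D where "\<And>A B. \<lbrakk>finite A; finite B; A \<subseteq> V; B \<subseteq> V; A \<inter> B = {}; A \<noteq> {};
    \<And>a. a \<in> A \<Longrightarrow> D \<le> card (nbrs E a \<inter> B)\<rbrakk> \<Longrightarrow> card A < card B"
proof -
  \<comment> \<open>The summand \<open>s ^ 4\<close> lets the final union bound over the colorings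
    of \<open>B\<close> succeed, the summand \<open>s\<close> provides subsets of size
    \<open>s\<close>, and the 1 makes the comparison strict.\<close>
  define M where "M = {..<s ^ 4 + s + 1}"
  define T where "T = {\<tau>. \<tau> \<subseteq> M \<and> card \<tau> = s}"
  define t where "t = card T"
  have finM: "finite M" and cM: "s ^ 4 < card M" "s \<le> card M" by (auto simp: M_def)
  have finT: "finite T" using finM by (simp add: T_def)
  have t: "t > 0" using n_subsets[OF finM, of s] cM by (simp add: t_def T_def)
  obtain D where D: "2 * t * (t - 1) ^ D \<le> t ^ D" using exists_pow_small[OF t] by blast
  show thesis
  proof (rule that[of D])
    fix A B assume fin: "finite A" "finite B" and V: "A \<subseteq> V" "B \<subseteq> V" and dis: "A \<inter> B = {}" "A \<noteq> {}"
      and deg: "\<And>a. a \<in> A \<Longrightarrow> D \<le> card (nbrs E a \<inter> B)"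
    show "card A < card B"
    proof (rule ccontr)
      assume "\<not> card A < card B"
      then have BA: "card B \<le> card A" by simp
      obtain L where L: "L \<in> B \<rightarrow>\<^sub>E T" "card A \<le> 2 * card {a\<in>A. T \<subseteq> L ` (nbrs E a \<inter> B)}"
        by (rule exists_surjective_on_many[where N = "\<lambda>a. nbrs E a \<inter> B", OF fin finT t_def[symmetric] t D])
          (use deg in auto)
      define G where "G = {a\<in>A. T \<subseteq> L ` (nbrs E a \<inter> B)}"
      have G: "finite G" "G \<subseteq> A" "card A \<le> 2 * card G" using L(2) fin by (auto simp: G_def)
      have "G \<noteq> {}" using G(3) dis(2) fin by auto
      have LT: "finite (L b)" "card (L b) = s" if "b \<in> B" for b
      proof -
        have "L b \<in> T" using L(1) that by (rule PiE_mem)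
        then show "finite (L b)" "card (L b) = s" using finM finite_subset by (auto simp: T_def)
      qed
      \<comment> \<open>\<open>U c a\<close> consists of the colors in \<open>M\<close> that
        \<open>c\<close> does not use on the neighbors of \<open>a\<close> in \<open>B\<close>.
        \<open>X c\<close> contains every choice of lists on \<open>G\<close> to which
        \<open>c\<close> might extend, edges inside \<open>G\<close> being ignored.\<close>
      define U where "U c a = M - c ` (nbrs E a \<inter> B)" for c :: "'a \<Rightarrow> nat" and a
      define X where "X c = PiE G (\<lambda>a. {\<tau>. \<tau> \<subseteq> M \<and> card \<tau> = s \<and> \<tau> \<inter> U c a \<noteq> {}})" for c
      have X: "card M ^ card G * card (X c) \<le> (s * s * t) ^ card G" if c: "c \<in> PiE B L" for c
      proof -
        \<comment> \<open>An \<open>s\<close>-subset \<open>\<tau>\<close> of \<open>U c a\<close>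
          would be the list of some neighbor \<open>b\<close> of \<open>a\<close> in
          \<open>B\<close>, since \<open>a\<close> sees all of \<open>T\<close>; but then
          \<open>c b\<close> is a used color lying in \<open>\<tau>\<close>.\<close>
        have "card (U c a) \<le> s" if a: "a \<in> G" for a
        proof (rule ccontr)
          assume "\<not> card (U c a) \<le> s"
          then obtain \<tau> where \<tau>: "\<tau> \<subseteq> U c a" "card \<tau> = s"
            using obtain_subset_with_card_n[of s "U c a"] by auto
          then have "\<tau> \<in> T" by (auto simp: T_def U_def)
          then obtain b where b: "b \<in> nbrs E a \<inter> B" "L b = \<tau>" using a by (auto simp: G_def)
          then have "c b \<in> \<tau>" using c by (auto dest: PiE_mem)
          then show False using \<tau> b(1) by (auto simp: U_def)
        qed
        then have "card M * card {\<tau>. \<tau> \<subseteq> M \<and> card \<tau> = s \<and> \<tau> \<inter> U c a \<noteq> {}} \<le> s * s * t" if "a \<in> G" for a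
          unfolding t_def T_def by (intro card_sets_meeting[OF finM]) (use that in \<open>auto simp: U_def\<close>)
        then have "(\<Prod>a\<in>G. card M * card {\<tau>. \<tau> \<subseteq> M \<and> card \<tau> = s \<and> \<tau> \<inter> U c a \<noteq> {}})
            \<le> (\<Prod>a\<in>G. s * s * t)" by (intro prod_mono) auto
        then show ?thesis using G(1) by (simp add: X_def card_PiE prod.distrib)
      qed
      have finP: "finite (PiE B L)" using fin LT by (auto intro: finite_PiE)
      have "card M ^ card G * card (\<Union>c\<in>PiE B L. X c) \<le> card M ^ card G * (\<Sum>c\<in>PiE B L. card (X c))"
        by (intro mult_le_mono2 card_UN_le finP)
      also have "\<dots> = (\<Sum>c\<in>PiE B L. card M ^ card G * card (X c))" by (rule sum_distrib_left)
      also have "\<dots> \<le> (\<Sum>c\<in>PiE B L. (s * s * t) ^ card G)" by (intro sum_mono X)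
      also have "\<dots> = s ^ card B * (s * s * t) ^ card G" using fin LT by (simp add: card_PiE)
      also have "\<dots> \<le> (s ^ 4 * t) ^ card G"
      proof (cases "s = 0")
        case True
        then show ?thesis using \<open>G \<noteq> {}\<close> G(1) by (simp add: power_0_left)
      next
        case False
        \<comment> \<open>Here \<open>card B \<le> card A \<le> 2 * card G\<close>. The colorings of
          \<open>B\<close> thus contribute a factor of at most \<open>s ^ 2\<close> per vertex of
          \<open>G\<close>, which with \<open>s * s\<close> makes the \<open>s ^ 4\<close> in the
          size of \<open>M\<close>.\<close>
        have "s ^ card B \<le> s ^ (2 * card G)" using False BA G(3) by (intro power_increasing) auto
        then have "s ^ card B * (s * s * t) ^ card G \<le> s ^ (2 * card G) * (s * s * t) ^ card G"
          by (rule mult_le_mono1)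
        also have "\<dots> = (s ^ 4 * t) ^ card G"
          by (simp add: power_mult power_mult_distrib[symmetric] power2_eq_square power4_eq_xxxx mult_ac)
        finally show ?thesis .
      qed
      also have "\<dots> < (card M * t) ^ card G"
        using cM t \<open>G \<noteq> {}\<close> G(1) by (intro power_strict_mono) (auto simp: card_gt_0_iff)
      also have "\<dots> = card M ^ card G * card (G \<rightarrow>\<^sub>E T)"
        using G(1) by (simp add: card_PiE power_mult_distrib t_def)
      finally have less: "card (\<Union>c\<in>PiE B L. X c) < card (G \<rightarrow>\<^sub>E T)" by simp
      have "\<exists>K. K \<in> G \<rightarrow>\<^sub>E T \<and> K \<notin> (\<Union>c\<in>PiE B L. X c)"
      proof (rule ccontr)
        assume "\<not> ?thesis"
        then have sub: "G \<rightarrow>\<^sub>E T \<subseteq> (\<Union>c\<in>PiE B L. X c)" by blast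
        have "finite (X c)" for c
          unfolding X_def using G(1) finM by (intro finite_PiE) auto
        then have "finite (\<Union>c\<in>PiE B L. X c)" using finP by blast
        from card_mono[OF this sub] less show False by simp
      qed
      then obtain K where K: "K \<in> G \<rightarrow>\<^sub>E T" "\<And>c. c \<in> PiE B L \<Longrightarrow> K \<notin> X c" by blast
      \<comment> \<open>Vertices outside \<open>B\<close> and \<open>G\<close> receive an arbitrary
        list of size \<open>s\<close>.\<close>
      define F where "F x = (if x \<in> B then L x else if x \<in> G then K x else {..<s})" for x
      have F: "finite (F x) \<and> card (F x) = s" for x
      proof -
        have "finite (K x) \<and> card (K x) = s" if "x \<in> G"
          using PiE_mem[OF K(1) that] finM finite_subset by (auto simp: T_def)
        then show ?thesis using LT by (simp add: F_def)
      qed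
      have "\<exists>f. good_coloring V E f \<and> (\<forall>x\<in>V. f x \<in> F x)"
        by (rule assms[unfolded choosable_def, rule_format]) (rule F)
      then obtain f where f: "good_coloring V E f" "\<And>x. x \<in> V \<Longrightarrow> f x \<in> F x" by blast
      have "f b \<in> L b" if "b \<in> B" for b using f(2)[of b] V(2) that by (auto simp: F_def)
      then have "restrict f B \<in> PiE B L" by (auto simp: PiE_iff)
      from K(2)[OF this] obtain a where a: "a \<in> G" "K a \<inter> U (restrict f B) a = {}"
        using K(1) by (auto simp: X_def T_def PiE_iff Pi_iff)
      have "a \<notin> B" "a \<in> V" using a(1) G(2) dis(1) V(1) by auto
      then have "f a \<in> K a" using f(2)[of a] a(1) by (simp add: F_def)
      moreover have "K a \<subseteq> M" using PiE_mem[OF K(1) a(1)] by (simp add: T_def)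
      ultimately obtain b where b: "b \<in> nbrs E a \<inter> B" "f a = f b" using a(2) by (auto simp: U_def)
      then have "{b, a} \<in> E" "b \<in> V" using V(2) by (auto simp: nbrs_def)
      then show False using f(1) \<open>a \<in> V\<close> b(2) unfolding good_coloring_def by force
    qed
  qed
qed

section \<open>Edge counts and cuts in finite graphs\<close>

definition edges_between :: "'a set set \<Rightarrow> 'a set \<Rightarrow> 'a set \<Rightarrow> nat" where
  "edges_between E X Y = (\<Sum>x\<in>X. \<Sum>y\<in>Y. of_bool (y \<in> nbrs E x))"

lemma nbrs_sym: "y \<in> nbrs E x \<longleftrightarrow> x \<in> nbrs E y"
  by (simp add: nbrs_def insert_commute)

lemma edges_between_sym: "edges_between E X Y = edges_between E Y X"
  unfolding edges_between_def by (subst sum.swap) (simp add: nbrs_sym)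

lemma edges_between_Un_left:
  "finite X \<Longrightarrow> finite X' \<Longrightarrow> X \<inter> X' = {} \<Longrightarrow>
    edges_between E (X \<union> X') Y = edges_between E X Y + edges_between E X' Y"
  unfolding edges_between_def by (rule sum.union_disjoint)

lemma edges_between_Un_right:
  "finite Y \<Longrightarrow> finite Y' \<Longrightarrow> Y \<inter> Y' = {} \<Longrightarrow>
    edges_between E X (Y \<union> Y') = edges_between E X Y + edges_between E X Y'"
  using edges_between_Un_left[of Y Y' E X] by (simp add: edges_between_sym)

lemma edges_between_mono_right:
  "finite Y' \<Longrightarrow> Y \<subseteq> Y' \<Longrightarrow> edges_between E X Y \<le> edges_between E X Y'"
  unfolding edges_between_def by (intro sum_mono sum_mono2) auto

lemma edges_between_singleton: "finite Y \<Longrightarrow> edges_between E {x} Y = card (nbrs E x \<inter> Y)"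
  unfolding edges_between_def by (simp add: sum.If_cases of_bool_def Int_commute)

lemma edges_between_empty [simp]: "edges_between E {} Y = 0" "edges_between E X {} = 0"
  by (simp_all add: edges_between_def)

text \<open>Any maximum cut will do, since moving a vertex across it does not increase it.\<close>

lemma exists_balanced_cut:
  assumes fin: "finite W" and irr: "\<And>x. x \<in> W \<Longrightarrow> x \<notin> nbrs E x"
  obtains A where "A \<subseteq> W"
    "\<And>x. x \<in> A \<Longrightarrow> card (nbrs E x \<inter> W) \<le> 2 * card (nbrs E x \<inter> (W - A))"
    "\<And>x. x \<in> W - A \<Longrightarrow> card (nbrs E x \<inter> W) \<le> 2 * card (nbrs E x \<inter> A)"
proof -
  define cut where "cut A = edges_between E A (W - A)" for A
  have key: "card (nbrs E x \<inter> W) \<le> 2 * card (nbrs E x \<inter> (W - A))"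
    if A: "A \<subseteq> W" and max: "\<And>A'. A' \<subseteq> W \<Longrightarrow> cut A' \<le> cut A" and x: "x \<in> A" for A x
  proof -
    have finA: "finite A" using A fin finite_subset by blast
    have eq: "W - (A - {x}) = (W - A) \<union> {x}" "A = (A - {x}) \<union> {x}" using A x by auto
    have "cut (A - {x}) = edges_between E (A - {x}) (W - A) + edges_between E (A - {x}) {x}"
      unfolding cut_def eq(1) using fin x by (intro edges_between_Un_right) auto
    moreover have "cut A = edges_between E (A - {x}) (W - A) + edges_between E {x} (W - A)"
      unfolding cut_def using finA by (subst (1) eq(2), intro edges_between_Un_left) auto
    moreover have "cut (A - {x}) \<le> cut A" using A by (intro max) auto
    ultimately have "edges_between E {x} (A - {x}) \<le> edges_between E {x} (W - A)"
      by (simp add: edges_between_sym[of E "A - {x}"])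
    then have "card (nbrs E x \<inter> (A - {x})) \<le> card (nbrs E x \<inter> (W - A))"
      using finA fin by (simp add: edges_between_singleton)
    moreover have "nbrs E x \<inter> W = (nbrs E x \<inter> (A - {x})) \<union> (nbrs E x \<inter> (W - A))"
      using irr[of x] A x by auto
    ultimately show ?thesis
      using card_Un_le[of "nbrs E x \<inter> (A - {x})" "nbrs E x \<inter> (W - A)"] by simp
  qed
  have "finite (cut ` Pow W)" "cut ` Pow W \<noteq> {}" using fin by auto
  then obtain A where A: "A \<subseteq> W" "\<And>A'. A' \<subseteq> W \<Longrightarrow> cut A' \<le> cut A"
    using Max_in[of "cut ` Pow W"] Max_ge[of "cut ` Pow W"] by (metis (no_types, lifting) PowD PowI image_iff)
  have W: "W - (W - A) = A" using A by auto
  \<comment> \<open>The complement is a maximum cut as well, so the same argument handles the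
    vertices outside \<open>A\<close>.\<close>
  then have "cut (W - A) = cut A" by (simp add: cut_def edges_between_sym)
  then show thesis using that[of A] key[of A] key[of "W - A"] A W by simp
qed

section \<open>Bounded degrees and predimension in graphs with the expansion property\<close>

context
  fixes V :: "'a set" and E and D :: nat
  assumes irr: "\<And>x. x \<in> V \<Longrightarrow> x \<notin> nbrs E x"
    and expansion: "\<And>A B. \<lbrakk>finite A; finite B; A \<subseteq> V; B \<subseteq> V; A \<inter> B = {}; A \<noteq> {};
      \<And>a. a \<in> A \<Longrightarrow> D \<le> card (nbrs E a \<inter> B)\<rbrakk> \<Longrightarrow> card A < card B"
begin

text \<open>Otherwise every vertex has at least \<open>D\<close> neighbors across a balanced cut,
  and expansion makes each nonempty side strictly smaller than the other.\<close>

lemma exists_small_degree: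
  assumes W: "finite W" "W \<subseteq> V" "W \<noteq> {}"
  obtains x where "x \<in> W" "card (nbrs E x \<inter> W) < 2 * D"
proof (rule ccontr)
  assume "\<not> thesis"
  then have big: "2 * D \<le> card (nbrs E x \<inter> W)" if "x \<in> W" for x using that \<open>\<And>x. _ \<Longrightarrow> _ \<Longrightarrow> thesis\<close> by force
  obtain A where A: "A \<subseteq> W"
    "\<And>x. x \<in> A \<Longrightarrow> card (nbrs E x \<inter> W) \<le> 2 * card (nbrs E x \<inter> (W - A))"
    "\<And>x. x \<in> W - A \<Longrightarrow> card (nbrs E x \<inter> W) \<le> 2 * card (nbrs E x \<inter> A)"
    using exists_balanced_cut[OF W(1)] irr W(2) by blast
  have finA: "finite A" using A(1) W(1) finite_subset by blast
  have 1: "card A < card (W - A)" if "A \<noteq> {}"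
    using that A(1) W finA big A(2) by (intro expansion) force+
  have 2: "card (W - A) < card A" if "W - A \<noteq> {}"
    using that A(1) W finA big A(3) by (intro expansion) force+
  show False
  proof (cases "A = {}")
    case True then show False using 2 W by simp
  next
    case False
    with 1 have less: "card A < card (W - A)" .
    then have "W - A \<noteq> {}" by (metis card.empty not_less0)
    with less 2 show False by simp
  qed
qed

text \<open>Deleting a vertex of degree below \<open>2 * D\<close> loses fewer than
  \<open>4 * D\<close> ordered pairs of adjacent vertices. The bound is what makes the empty set
  \<open>strong\<close>.\<close>

lemma edges_between_self_le:
  assumes "finite W" "W \<subseteq> V"
  shows "edges_between E W W \<le> 4 * D * card W"
  using assms
proof (induction "card W" arbitrary: W)
  case 0
  then show ?case by simp
next
  case (Suc n)
  then have "W \<noteq> {}" by auto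
  then obtain x where x: "x \<in> W" "card (nbrs E x \<inter> W) < 2 * D"
    using exists_small_degree Suc.prems by blast
  define W' where "W' = W - {x}"
  have W: "W = W' \<union> {x}" "W' \<inter> {x} = {}" "finite W'" "W' \<subseteq> V" using x Suc.prems by (auto simp: W'_def)
  have "n = card W'" using Suc x by (simp add: W'_def)
  with Suc.hyps(1) W have IH: "edges_between E W' W' \<le> 4 * D * card W'" by blast
  have "edges_between E W W = edges_between E W' W' + edges_between E W' {x} + edges_between E {x} W"
    using edges_between_Un_left[of W' "{x}" E W] edges_between_Un_right[of W' "{x}" E W'] W by simp
  also have "edges_between E W' {x} = edges_between E {x} W'" by (rule edges_between_sym)
  also have "edges_between E {x} W' \<le> edges_between E {x} W"
    using Suc.prems W by (intro edges_between_mono_right) auto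
  also have "edges_between E {x} W < 2 * D" using x(2) Suc.prems by (simp add: edges_between_singleton)
  finally have "edges_between E W W \<le> 4 * D * card W' + 4 * D" using IH by linarith
  also have "\<dots> = 4 * D * card W" using W by (simp add: card_insert_if)
  finally show ?case .
qed

text \<open>A vertex of degree below \<open>2 * D\<close> is put last, and the remaining vertices
  are ordered by induction.\<close>

lemma finite_well_order_small_degree:
  assumes "finite W" "W \<subseteq> V"
  shows "\<exists>r. well_order_on W r \<and> (\<forall>x\<in>W. card (nbrs E x \<inter> underS r x) < 2 * D)"
  using assms
proof (induction "card W" arbitrary: W)
  case 0
  then show ?case by (intro exI[of _ "{}"]) auto
next
  case (Suc n)
  then have "W \<noteq> {}" by auto
  then obtain x where x: "x \<in> W" "card (nbrs E x \<inter> W) < 2 * D"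
    using exists_small_degree Suc.prems by blast
  define W' where "W' = W - {x}"
  have W: "W = insert x W'" "x \<notin> W'" "finite W'" "W' \<subseteq> V" using x Suc.prems by (auto simp: W'_def)
  have "n = card W'" using Suc x by (simp add: W'_def)
  with Suc.hyps(1) W obtain r where r: "well_order_on W' r"
    "\<And>y. y \<in> W' \<Longrightarrow> card (nbrs E y \<inter> underS r y) < 2 * D" by blast
  define r' where "r' = r \<union> W \<times> {x}"
  note rD = well_order_onD[OF r(1)]
  have "well_order_on W r'"
  proof (rule well_order_onI)
    show "r' \<subseteq> W \<times> W" using rD(1) W by (auto simp: r'_def)
    show "(y, y) \<in> r'" if "y \<in> W" for y using that W rD(2) by (auto simp: r'_def)
    show "(y, z) \<in> r'" if "(y, u) \<in> r'" "(u, z) \<in> r'" for y u z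
    proof (cases "z = x")
      case True then show ?thesis using that rD(1)[of y u] W by (auto simp: r'_def)
    next
      case False
      then show ?thesis using that rD(1)[of u z] rD(3)[of y u z] W(2) by (auto simp: r'_def)
    qed
    show "y = z" if "(y, z) \<in> r'" "(z, y) \<in> r'" for y z
      using that rD(1)[of y z] rD(1)[of z y] rD(4)[of y z] W(2) by (auto simp: r'_def)
    show "\<exists>m\<in>A. \<forall>a\<in>A. (m, a) \<in> r'" if A: "A \<subseteq> W" "A \<noteq> {}" for A
    proof (cases "A \<subseteq> {x}")
      case True then show ?thesis using A by (auto simp: r'_def)
    next
      case False
      then have "A - {x} \<subseteq> W'" "A - {x} \<noteq> {}" using A W by auto
      then obtain m where "m \<in> A - {x}" "\<And>a. a \<in> A - {x} \<Longrightarrow> (m, a) \<in> r"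
        using well_order_on_least[OF r(1)] by blast
      then show ?thesis using A by (intro bexI[of _ m]) (auto simp: r'_def)
    qed
  qed
  moreover have "card (nbrs E y \<inter> underS r' y) < 2 * D" if y: "y \<in> W" for y
  proof (cases "y = x")
    case True
    have "underS r' x \<subseteq> W" using rD(1) W by (auto simp: r'_def underS_def)
    then have "card (nbrs E x \<inter> underS r' x) \<le> card (nbrs E x \<inter> W)"
      using Suc.prems by (intro card_mono) auto
    then show ?thesis using x True by simp
  next
    case False
    then have "underS r' y = underS r y" by (auto simp: r'_def underS_def)
    then show ?thesis using r(2) y False W by simp
  qed
  ultimately show ?case by blast
qed

text \<open>
  The condition says that the predimension \<^term>\<open>4 * D * card F - edges_between E F F\<close> of a
  finite set of vertices, relative to \<^term>\<open>U\<close>, is never negative (edges inside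
  \<^term>\<open>F\<close> being counted twice).  Such sets \<^term>\<open>U\<close> exhaust the graph in
  finite steps.
\<close>

definition strong :: "'a set \<Rightarrow> bool" where
  "strong U \<longleftrightarrow> U \<subseteq> V \<and> (\<forall>F U0. finite F \<and> F \<subseteq> V - U \<and> finite U0 \<and> U0 \<subseteq> U \<longrightarrow>
     edges_between E F F + 2 * edges_between E F U0 \<le> 4 * D * card F)"

lemma strong_empty: "strong {}"
  using edges_between_self_le by (auto simp: strong_def)

text \<open>Tested on \<open>F = {x}\<close>, strength bounds twice the number of neighbors of
  \<open>x\<close> in any finite part of \<open>U\<close> by \<open>4 * D\<close>.\<close>

lemma strong_nbrs:
  assumes U: "strong U" and x: "x \<in> V - U"
  shows "finite (nbrs E x \<inter> U)" "card (nbrs E x \<inter> U) \<le> 2 * D"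
proof -
  have small: "card Y \<le> 2 * D" if "finite Y" "Y \<subseteq> nbrs E x \<inter> U" for Y
  proof -
    have "edges_between E {x} {x} + 2 * edges_between E {x} Y \<le> 4 * D * card {x}"
      using U x that unfolding strong_def by blast
    moreover have "nbrs E x \<inter> Y = Y" using that by blast
    ultimately show ?thesis using that by (simp add: edges_between_singleton)
  qed
  show fin: "finite (nbrs E x \<inter> U)"
  proof (rule ccontr)
    assume "infinite (nbrs E x \<inter> U)"
    then obtain Y where "finite Y" "card Y = Suc (2 * D)" "Y \<subseteq> nbrs E x \<inter> U"
      using infinite_arbitrarily_large by blast
    then show False using small[of Y] by simp
  qed
  show "card (nbrs E x \<inter> U) \<le> 2 * D" using small[OF fin] by blast
qed

text \<open>A finite \<open>C\<close> containing \<open>x\<close> is chosen with least predimension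
  over \<open>U\<close>, the set \<open>U0\<close> recording finitely many of the edges into
  \<open>U\<close>. A further finite set \<open>F\<close> cannot lower this minimum, so its
  predimension relative to the enlarged set is nonnegative.\<close>

lemma strong_extend:
  assumes U: "strong U" and x: "x \<in> V"
  shows "\<exists>C. finite C \<and> x \<in> U \<union> C \<and> strong (U \<union> C)"
proof (cases "x \<in> U")
  case True
  then show ?thesis using U by (intro exI[of _ "{}"]) auto
next
  case False
  \<comment> \<open>Truncated subtraction is harmless on pairs satisfying \<open>P\<close>, because
    strength of \<open>U\<close> makes the difference nonnegative.\<close>
  define \<delta> where "\<delta> = (\<lambda>(C, U0). 4 * D * card C - (edges_between E C C + 2 * edges_between E C U0))"
  define P where "P = (\<lambda>(C, U0). finite C \<and> x \<in> C \<and> C \<subseteq> V - U \<and> finite U0 \<and> U0 \<subseteq> U)"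
  have \<delta>: "edges_between E C C + 2 * edges_between E C U0 + \<delta> (C, U0) = 4 * D * card C" if "P (C, U0)" for C U0
  proof -
    have "edges_between E C C + 2 * edges_between E C U0 \<le> 4 * D * card C"
      using U that unfolding strong_def P_def by blast
    then show ?thesis by (simp add: \<delta>_def)
  qed
  have "P ({x}, {})" using x False by (simp add: P_def)
  then obtain p where "P p" "\<And>q. P q \<Longrightarrow> \<delta> p \<le> \<delta> q"
    using ex_has_least_nat[of P _ \<delta>] by blast
  then obtain C U0 where PC: "P (C, U0)" and min: "\<And>q. P q \<Longrightarrow> \<delta> (C, U0) \<le> \<delta> q"
    by (metis surj_pair)
  have C: "finite C" "x \<in> C" "C \<subseteq> V - U" "finite U0" "U0 \<subseteq> U" using PC by (auto simp: P_def)
  have "strong (U \<union> C)"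
    unfolding strong_def
  proof (intro conjI allI impI)
    show "U \<union> C \<subseteq> V" using C U by (auto simp: strong_def)
    fix F W assume FW: "finite F \<and> F \<subseteq> V - (U \<union> C) \<and> finite W \<and> W \<subseteq> U \<union> C"
    define U1 where "U1 = U0 \<union> (W \<inter> U)"
    have U1: "finite U1" "U1 \<subseteq> U" "U0 \<subseteq> U1" using C FW by (auto simp: U1_def)
    have P1: "P (C \<union> F, U1)" using C FW U1 by (auto simp: P_def)
    have FC: "F \<inter> C = {}" "U1 \<inter> C = {}" using FW C U1 by auto
    have "edges_between E (C \<union> F) (C \<union> F) = edges_between E C C + 2 * edges_between E F C + edges_between E F F"
      using FW C FC edges_between_sym[of E C F]
      by (simp add: edges_between_Un_left edges_between_Un_right Int_commute)
    moreover have "edges_between E (C \<union> F) U1 = edges_between E C U1 + edges_between E F U1"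
      using FW C FC by (intro edges_between_Un_left) auto
    moreover have "edges_between E C U0 \<le> edges_between E C U1"
      using U1 by (intro edges_between_mono_right)
    moreover have "card (C \<union> F) = card C + card F"
      using FW C FC by (intro card_Un_disjoint) auto
    moreover note \<delta>[OF PC] \<delta>[OF P1] min[OF P1]
    ultimately have "edges_between E F F + 2 * (edges_between E F U1 + edges_between E F C) \<le> 4 * D * card F"
      by (simp add: algebra_simps)
    moreover have "edges_between E F (U1 \<union> C) = edges_between E F U1 + edges_between E F C"
      using C U1 FC by (intro edges_between_Un_right) auto
    moreover have "edges_between E F W \<le> edges_between E F (U1 \<union> C)"
      using C U1 FW by (intro edges_between_mono_right) (auto simp: U1_def)
    ultimately show "edges_between E F F + 2 * edges_between E F W \<le> 4 * D * card F"
      by (elim order.trans[rotated]) simp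
  qed
  then show ?thesis using C by blast
qed

text \<open>The condition involves only finite subsets \<open>U0\<close> of the union, and each of
  these lies in a single member of a nonempty chain.\<close>

lemma strong_Union_chain:
  assumes ch: "\<And>X Y. X \<in> \<C> \<Longrightarrow> Y \<in> \<C> \<Longrightarrow> X \<subseteq> Y \<or> Y \<subseteq> X" and st: "\<And>X. X \<in> \<C> \<Longrightarrow> strong X"
  shows "strong (\<Union>\<C>)"
proof (cases "\<C> = {}")
  case True
  then show ?thesis using strong_empty by simp
next
  case False
  show ?thesis
    unfolding strong_def
  proof (intro conjI allI impI)
    show "\<Union>\<C> \<subseteq> V" using st by (auto simp: strong_def)
    fix F U0 assume F: "finite F \<and> F \<subseteq> V - \<Union>\<C> \<and> finite U0 \<and> U0 \<subseteq> \<Union>\<C>"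
    have "subset.chain UNIV \<C>" using ch by (auto simp: subset_chain_def)
    with F False obtain X where X: "X \<in> \<C>" "U0 \<subseteq> X"
      using finite_subset_Union_chain[of U0 \<C>] by blast
    then have "F \<subseteq> V - X" using F by blast
    then show "edges_between E F F + 2 * edges_between E F U0 \<le> 4 * D * card F"
      using st[OF X(1)] X(2) F unfolding strong_def by blast
  qed
qed

text \<open>The graph is exhausted by an increasing chain of strong sets, each adding finitely many
  vertices to the union of the earlier ones. A new vertex has at most \<open>2 * D\<close> neighbors
  in that strong union and fewer than \<open>2 * D\<close> smaller ones in its own finite
  layer.\<close>

lemma well_order_small_degree:
  obtains r where "well_order_on V r"
    "\<And>x. x \<in> V \<Longrightarrow> finite (nbrs E x \<inter> underS r x) \<and> card (nbrs E x \<inter> underS r x) < 4 * D + 1"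
proof -
  define s where "s = |V|"
  have s: "well_order_on V s" unfolding s_def by (rule card_of_well_order_on)
  then have wf: "wf (s - Id)" by (simp add: well_order_on_def)
  define ext where "ext U x = U \<union> (SOME C. finite C \<and> x \<in> U \<union> C \<and> strong (U \<union> C))" for U x
  define G where "G = wfrec (s - Id) (\<lambda>g x. ext (\<Union>y\<in>underS s x. g y) x)"
  define U where "U x = (\<Union>y\<in>underS s x. G y)" for x
  have G: "G x = ext (U x) x" for x
  proof -
    have "G x = ext (\<Union>y\<in>underS s x. cut G (s - Id) x y) x"
      unfolding G_def by (rule wfrec[OF wf])
    also have "(\<Union>y\<in>underS s x. cut G (s - Id) x y) = U x"
      unfolding U_def by (rule SUP_cong) (auto simp: cut_def underS_def)
    finally show ?thesis .
  qed
  have mono: "G y \<subseteq> G x" if "y \<in> underS s x" for x y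
    using that unfolding G[of x] by (auto simp: ext_def U_def)
  have st: "strong (G x) \<and> strong (U x)" if "x \<in> V" for x
    using wf that
  proof (induction x rule: wf_induct_rule)
    case (less x)
    have uV: "y \<in> V" if "y \<in> underS s x" for y
      using well_order_onD(1)[OF s, of y x] that by (auto simp: underS_def)
    have "strong (\<Union>(G ` underS s x))"
    proof (rule strong_Union_chain)
      fix X Y assume "X \<in> G ` underS s x" "Y \<in> G ` underS s x"
      then obtain y z where yz: "y \<in> underS s x" "z \<in> underS s x" "X = G y" "Y = G z" by blast
      have "y = z \<or> y \<in> underS s z \<or> z \<in> underS s y"
        using well_order_onD(5)[OF s uV[OF yz(1)] uV[OF yz(2)]] by (auto simp: underS_def)
      then show "X \<subseteq> Y \<or> Y \<subseteq> X" using yz mono by blast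
    next
      fix X assume "X \<in> G ` underS s x"
      then show "strong X" using less.IH uV by (auto simp: underS_def)
    qed
    then have U: "strong (U x)" by (simp add: U_def)
    with someI_ex[OF strong_extend[OF U less.prems]] show ?case by (simp add: G[of x] ext_def)
  qed
  have new: "x \<in> G x" "finite (G x - U x)" if "x \<in> V" for x
    using someI_ex[OF strong_extend[of "U x" x]] st[OF that] that
    by (auto simp: G[of x] ext_def intro: finite_subset[rotated])
  \<comment> \<open>The index \<open>k x\<close> is the first stage at which \<open>x\<close>
    appears, so the fibres of \<open>k\<close> lie in the finite layers
    \<open>G i - U i\<close>.\<close>
  have "\<exists>i. i \<in> V \<and> x \<in> G i \<and> x \<notin> U i" if x: "x \<in> V" for x
  proof -
    obtain i where i: "i \<in> {i\<in>V. x \<in> G i}" "\<And>j. j \<in> {i\<in>V. x \<in> G i} \<Longrightarrow> (i, j) \<in> s"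
      by (rule well_order_on_least[OF s, of "{i\<in>V. x \<in> G i}"]) (use new(1)[OF x] x in auto)
    have "x \<notin> G j" if j: "j \<in> underS s i" for j
    proof
      assume "x \<in> G j"
      moreover have ji: "j \<noteq> i" "(j, i) \<in> s" using j by (auto simp: underS_def)
      ultimately have "(i, j) \<in> s" using i(2)[of j] well_order_onD(1)[OF s ji(2)] by simp
      then show False using well_order_onD(4)[OF s ji(2)] ji(1) by simp
    qed
    then show ?thesis using i(1) by (auto simp: U_def)
  qed
  then obtain k where k: "\<And>x. x \<in> V \<Longrightarrow> k x \<in> V \<and> x \<in> G (k x) \<and> x \<notin> U (k x)" by metis
  have "\<exists>\<rho>. well_order_on {x\<in>V. k x = i} \<rho> \<and>
      (\<forall>x\<in>{x\<in>V. k x = i}. card (nbrs E x \<inter> underS \<rho> x) < 2 * D)" if i: "i \<in> V" for i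
  proof (rule finite_well_order_small_degree)
    have "{x\<in>V. k x = i} \<subseteq> G i - U i" using k by blast
    then show "finite {x\<in>V. k x = i}" using new(2)[OF i] finite_subset by blast
  qed auto
  then have "\<forall>i\<in>V. \<exists>\<rho>. well_order_on {x\<in>V. k x = i} \<rho> \<and>
      (\<forall>x\<in>{x\<in>V. k x = i}. card (nbrs E x \<inter> underS \<rho> x) < 2 * D)" by (rule ballI)
  from bchoice[OF this] obtain \<rho> where \<rho>: "\<And>i. i \<in> V \<Longrightarrow> well_order_on {x\<in>V. k x = i} (\<rho> i)"
    "\<And>i x. i \<in> V \<Longrightarrow> x \<in> {x\<in>V. k x = i} \<Longrightarrow> card (nbrs E x \<inter> underS (\<rho> i) x) < 2 * D" by auto
  obtain r where r: "well_order_on V r"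
    "\<And>x. x \<in> V \<Longrightarrow> underS r x = {y\<in>V. k y \<in> underS s (k x)} \<union> underS (\<rho> (k x)) x"
    by (rule well_order_lex[where I = V and s = s and k = k and V = V and \<rho> = \<rho>]) (use s k \<rho>(1) in auto)
  show thesis
  proof (rule that[OF r(1)])
    fix x assume x: "x \<in> V"
    have kx: "k x \<in> V" using k x by blast
    have "nbrs E x \<inter> {y\<in>V. k y \<in> underS s (k x)} \<subseteq> nbrs E x \<inter> U (k x)"
      using k by (auto simp: U_def)
    moreover have "strong (U (k x))" "x \<in> V - U (k x)" using st k x by auto
    note nb = strong_nbrs[OF this]
    ultimately have 1: "finite (nbrs E x \<inter> {y\<in>V. k y \<in> underS s (k x)})"
      "card (nbrs E x \<inter> {y\<in>V. k y \<in> underS s (k x)}) \<le> 2 * D"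
      using finite_subset card_mono[OF nb(1)] nb by (blast, meson le_trans)
    have "underS (\<rho> (k x)) x \<subseteq> {y\<in>V. k y = k x}"
      using well_order_onD(1)[OF \<rho>(1)[OF kx]] unfolding underS_def by blast
    moreover have "{y\<in>V. k y = k x} \<subseteq> G (k x) - U (k x)" using k by force
    ultimately have 2: "finite (nbrs E x \<inter> underS (\<rho> (k x)) x)"
      using new(2)[OF kx] by (meson finite_Int finite_subset)
    have 3: "card (nbrs E x \<inter> underS (\<rho> (k x)) x) < 2 * D" using \<rho>(2)[OF kx] x by blast
    show "finite (nbrs E x \<inter> underS r x) \<and> card (nbrs E x \<inter> underS r x) < 4 * D + 1"
      unfolding r(2)[OF x] Int_Un_distrib
      using 1 2 3 card_Un_le[of "nbrs E x \<inter> {y\<in>V. k y \<in> underS s (k x)}" "nbrs E x \<inter> underS (\<rho> (k x)) x"]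
      by simp
  qed
qed

end

section \<open>Closed unbounded and stationary sets\<close>

text \<open>Failure of cofinality yields only a weak upper bound \<open>c\<close>; an infinite
  cardinal has no largest element, so some \<open>b\<close> above \<open>c\<close> is a strict
  bound.\<close>

lemma regularCard_bounded:
  assumes r: "Cinfinite r" "regularCard r" and A: "A \<subseteq> Field r" "|A| <o r"
  obtains b where "b \<in> Field r" "A \<subseteq> underS r b"
proof -
  have w: "well_order_on (Field r) r" using r by (simp add: Card_order_wo)
  have "\<not> cofinal A r"
    using r A not_ordLess_ordIso unfolding regularCard_def by blast
  then obtain c where "c \<in> Field r" "\<not> (\<exists>a\<in>A. c \<noteq> a \<and> (c, a) \<in> r)"
    unfolding cofinal_def by blast
  then have c: "c \<in> Field r" "\<And>a. a \<in> A \<Longrightarrow> a = c \<or> (c, a) \<notin> r" by auto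
  obtain b where b: "b \<in> Field r" "c \<noteq> b" "(c, b) \<in> r"
    using infinite_Card_order_limit[of r c] r c by (auto simp: cinfinite_def)
  have "a \<in> underS r b" if "a \<in> A" for a
  proof -
    have "(a, c) \<in> r" using c(2)[OF that] well_order_onD(2,5)[OF w] c(1) A(1) that by blast
    then show ?thesis using underS_trans2[OF w] b by (auto simp: underS_def)
  qed
  then show thesis using that b by blast
qed

lemma regular_uncountableD:
  assumes "regular_uncountable r"
  shows "Cinfinite r" "regularCard r" "well_order_on (Field r) r" "natLeq <o r"
  using assms natLeq_ordLeq_cinfinite natLeq_Cinfinite cinfinite_mono[OF ordLess_imp_ordLeq]
    Card_order_wo[of r]
  unfolding regular_uncountable_def by blast+

lemma card_of_countable_ordLess:
  assumes "natLeq <o r"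
  shows "|range (q :: nat \<Rightarrow> 'a)| <o r"
  using ordIso_ordLess_trans[OF card_of_nat assms] card_of_image ordLeq_ordLess_trans by blast

lemma card_of_finite_ordLess:
  assumes "Cinfinite r" "finite A"
  shows "|A| <o r"
  using assms Cfinite_ordLess_Cinfinite[of "|A|" r] card_of_Card_order
  by (auto simp: cfinite_def Field_card_of)

lemma not_card_of_ordLess: "Card_order \<mu> \<Longrightarrow> \<not> |A| <o \<mu> \<Longrightarrow> \<mu> \<le>o |A|"
  using not_ordLess_iff_ordLeq[OF _ card_of_Well_order] by (auto simp: card_order_on_def)

text \<open>Above any \<open>a\<close>, a closure point arises as the supremum
  \<open>\<delta>\<close> of an \<omega>-sequence in which each term bounds \<open>g\<close> on
  everything below the previous term. Regularity and uncountability of \<open>r\<close> keep the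
  supremum inside \<open>Field r\<close>.\<close>

lemma club_closed_under:
  assumes r: "regular_uncountable r" and g: "\<And>a. a \<in> Field r \<Longrightarrow> g a \<in> Field r"
  shows "club r {\<delta>\<in>Field r. underS r \<delta> \<noteq> {} \<and> (\<forall>\<alpha>\<in>underS r \<delta>. g \<alpha> \<in> underS r \<delta>)}"
    (is "club r ?C")
  unfolding club_def
proof (intro conjI ballI impI)
  note rD = regular_uncountableD[OF r]
  note w = rD(3)
  show "?C \<subseteq> Field r" by blast
  show "cofinal ?C r"
    unfolding cofinal_def
  proof
    fix a assume a: "a \<in> Field r"
    have "\<exists>c. c \<in> Field r \<and> b \<in> underS r c \<and> g b \<in> underS r c \<and> g ` underS r b \<subseteq> underS r c"
      if b: "b \<in> Field r" for b
    proof -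
      have sub: "underS r b \<subseteq> Field r" by (rule Order_Relation.underS_Field)
      have "|g ` underS r b| <o r"
        using card_of_image[of g "underS r b"] card_of_underS[OF _ b] rD(1)
        by (blast intro: ordLeq_ordLess_trans)
      then have less: "|{b, g b} \<union> g ` underS r b| <o r"
        by (intro Un_Cinfinite_bound_strict[OF card_of_finite_ordLess[OF rD(1)] _ rD(1)]) simp
      have "{b, g b} \<union> g ` underS r b \<subseteq> Field r" using g b sub by blast
      from regularCard_bounded[OF rD(1,2) this less]
      obtain c where "c \<in> Field r" "{b, g b} \<union> g ` underS r b \<subseteq> underS r c" .
      then show ?thesis by auto
    qed
    then obtain h where h: "\<And>b. b \<in> Field r \<Longrightarrow> h b \<in> Field r \<and> b \<in> underS r (h b) \<and>
        g b \<in> underS r (h b) \<and> g ` underS r b \<subseteq> underS r (h b)" by metis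
    define q where "q n = (h ^^ n) a" for n
    have q: "q n \<in> Field r" "q (Suc n) = h (q n)" "q 0 = a" for n
    proof -
      show "q n \<in> Field r" by (induction n) (use a h in \<open>auto simp: q_def\<close>)
    qed (auto simp: q_def)
    have "range q \<subseteq> Field r" using q by blast
    then obtain b where b: "b \<in> Field r" "range q \<subseteq> underS r b"
      by (rule regularCard_bounded[OF rD(1,2) _ card_of_countable_ordLess[OF rD(4)]])
    have ub: "b \<in> {z\<in>Field r. \<forall>n. (q n, z) \<in> r}"
      using b by (auto simp: underS_def subset_eq)
    obtain \<delta> where \<delta>: "\<delta> \<in> {z\<in>Field r. \<forall>n. (q n, z) \<in> r}"
      "\<And>z. z \<in> {z\<in>Field r. \<forall>n. (q n, z) \<in> r} \<Longrightarrow> (\<delta>, z) \<in> r"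
      by (rule well_order_on_least[OF w, of "{z\<in>Field r. \<forall>n. (q n, z) \<in> r}"])
        (use ub in auto)
    have q\<delta>: "q n \<in> underS r \<delta>" for n
    proof (rule underS_trans[OF w])
      show "q n \<in> underS r (q (Suc n))" using h[OF q(1)[of n]] q(2)[of n] by simp
      show "(q (Suc n), \<delta>) \<in> r \<or> q (Suc n) \<in> underS r \<delta>" using \<delta>(1) by blast
    qed
    have "g \<alpha> \<in> underS r \<delta>" if \<alpha>: "\<alpha> \<in> underS r \<delta>" for \<alpha>
    proof -
      have \<alpha>': "\<alpha> \<in> Field r" "(\<alpha>, \<delta>) \<in> r" "\<alpha> \<noteq> \<delta>"
        using \<alpha> by (auto simp: underS_def intro: FieldI1)
      then have "(\<delta>, \<alpha>) \<notin> r" using well_order_onD(4)[OF w] by blast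
      then obtain n where "(q n, \<alpha>) \<notin> r" using \<delta>(2)[of \<alpha>] \<alpha>'(1) by auto
      then have "\<alpha> \<in> underS r (q n)" using not_in_underS_iff[OF w \<alpha>'(1) q(1)[of n]] by blast
      then have "g \<alpha> \<in> underS r (q (Suc n))" using h[OF q(1)[of n]] q(2)[of n] by auto
      then show ?thesis using underS_trans[OF w] q\<delta> by blast
    qed
    moreover have "a \<in> underS r \<delta>" using q\<delta>[of 0] q(3) by simp
    ultimately show "\<exists>b\<in>?C. a \<noteq> b \<and> (a, b) \<in> r"
      using \<delta>(1) by (intro bexI[of _ \<delta>]) (auto simp: underS_def)
  qed
  fix \<delta> assume \<delta>: "\<delta> \<in> Field r" "underS r \<delta> \<noteq> {} \<and>
      (\<forall>\<beta>\<in>underS r \<delta>. \<exists>\<gamma>\<in>?C \<inter> underS r \<delta>. \<beta> \<in> underS r \<gamma>)"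
  have "g \<alpha> \<in> underS r \<delta>" if \<alpha>: "\<alpha> \<in> underS r \<delta>" for \<alpha>
  proof -
    obtain \<gamma> where "\<gamma> \<in> ?C" "\<gamma> \<in> underS r \<delta>" "\<alpha> \<in> underS r \<gamma>" using \<delta>(2) \<alpha> by blast
    then show ?thesis using underS_trans[OF w, of "g \<alpha>" \<gamma> \<delta>] by blast
  qed
  then show "\<delta> \<in> ?C" using \<delta> by blast
qed

lemma club_next:
  assumes "club r C" "a \<in> Field r"
  shows "\<exists>c. c \<in> C \<and> c \<in> Field r \<and> a \<in> underS r c"
  using assms unfolding club_def cofinal_def underS_def by blast

text \<open>With \<open>g\<close> and \<open>h\<close> moving up into \<open>C\<close> and into
  \<open>D\<close>, a point closed under \<open>h (g \<alpha>)\<close> is a limit of points of both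
  sets and hence belongs to both.\<close>

lemma club_Int:
  assumes r: "regular_uncountable r" and C: "club r C" and D: "club r D"
  obtains B where "club r B" "B \<subseteq> C \<inter> D"
proof -
  note w = regular_uncountableD(3)[OF r]
  obtain g where g: "\<And>a. a \<in> Field r \<Longrightarrow> g a \<in> C \<and> g a \<in> Field r \<and> a \<in> underS r (g a)"
    using club_next[OF C] by metis
  obtain h where h: "\<And>a. a \<in> Field r \<Longrightarrow> h a \<in> D \<and> h a \<in> Field r \<and> a \<in> underS r (h a)"
    using club_next[OF D] by metis
  let ?B = "{\<delta>\<in>Field r. underS r \<delta> \<noteq> {} \<and> (\<forall>\<alpha>\<in>underS r \<delta>. h (g \<alpha>) \<in> underS r \<delta>)}"
  have "club r ?B" by (rule club_closed_under[OF r]) (use g h in blast)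
  moreover have "\<delta> \<in> C \<inter> D" if \<delta>: "\<delta> \<in> ?B" for \<delta>
  proof -
    have lt: "\<beta> \<in> underS r (g \<beta>)" "g \<beta> \<in> underS r (h (g \<beta>))" "h (g \<beta>) \<in> underS r \<delta>"
      if "\<beta> \<in> underS r \<delta>" for \<beta>
      using g h \<delta> that Order_Relation.underS_Field[of r \<delta>] by blast+
    have "\<exists>\<gamma>\<in>C \<inter> underS r \<delta>. \<beta> \<in> underS r \<gamma>" "\<exists>\<gamma>\<in>D \<inter> underS r \<delta>. \<beta> \<in> underS r \<gamma>"
      if "\<beta> \<in> underS r \<delta>" for \<beta>
    proof -
      have \<beta>: "\<beta> \<in> Field r" using that Order_Relation.underS_Field by fast
      show "\<exists>\<gamma>\<in>C \<inter> underS r \<delta>. \<beta> \<in> underS r \<gamma>"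
        using underS_trans[OF w, of "g \<beta>" "h (g \<beta>)" \<delta>] lt[OF that] g[OF \<beta>] by blast
      show "\<exists>\<gamma>\<in>D \<inter> underS r \<delta>. \<beta> \<in> underS r \<gamma>"
        using underS_trans[OF w, of \<beta> "g \<beta>" "h (g \<beta>)"] lt[OF that] g[OF \<beta>] h by blast
    qed
    then show ?thesis using C D \<delta> unfolding club_def by blast
  qed
  ultimately show thesis using that by blast
qed

lemma stationary_Int_club:
  assumes r: "regular_uncountable r" and S: "stationary r S" and C: "club r C"
  shows "stationary r (S \<inter> C)"
  unfolding stationary_def
proof (intro conjI allI impI)
  show "S \<inter> C \<subseteq> Field r" using S by (auto simp: stationary_def)
  fix D assume "club r D"
  from club_Int[OF r C this] obtain B where "club r B" "B \<subseteq> C \<inter> D" .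
  then show "S \<inter> C \<inter> D \<noteq> {}" using S unfolding stationary_def by blast
qed

lemma stationary_Un:
  assumes r: "regular_uncountable r" and S: "stationary r (S \<union> T)"
  shows "stationary r S \<or> stationary r T"
proof (rule ccontr)
  assume "\<not> ?thesis"
  then obtain C D where C: "club r C" "S \<inter> C = {}" and D: "club r D" "T \<inter> D = {}"
    using S unfolding stationary_def by auto
  from club_Int[OF r C(1) D(1)] obtain B where "club r B" "B \<subseteq> C \<inter> D" .
  then show False using S C D unfolding stationary_def by blast
qed

lemma wf_recursive_set:
  assumes "wf R"
  obtains T where "\<And>x. x \<in> T \<longleftrightarrow> P x (T \<inter> {y. (y, x) \<in> R})"
proof
  define t where "t = wfrec R (\<lambda>f x. P x ({y. f y} \<inter> {y. (y, x) \<in> R}))"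
  fix x
  have "t x = P x ({y. cut t R x y} \<inter> {y. (y, x) \<in> R})"
    unfolding t_def by (rule wfrec[OF assms])
  also have "{y. cut t R x y} \<inter> {y. (y, x) \<in> R} = {y. t y} \<inter> {y. (y, x) \<in> R}"
    by (auto simp: cut_def)
  finally show "x \<in> {y. t y} \<longleftrightarrow> P x ({y. t y} \<inter> {y. (y, x) \<in> R})" by simp
qed

text \<open>
  The set \<^term>\<open>T\<close> below is defined by recursion, putting \<^term>\<open>\<alpha>\<close> into
  \<^term>\<open>T\<close> if \<^term>\<open>M \<alpha>\<close> contains few points chosen at earlier elements of
  \<^term>\<open>T\<close>.  Both \<^term>\<open>T\<close> and its complement then have the required property.
\<close>

lemma stationary_separate:
  fixes r :: "'a rel" and \<mu> :: "'m rel"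
  assumes r: "regular_uncountable r" and S: "stationary r S" and \<mu>: "Cinfinite \<mu>"
    and \<xi>: "\<And>\<alpha>. \<alpha> \<in> S \<Longrightarrow> \<xi> \<alpha> \<in> Field r \<and> \<xi> \<alpha> \<notin> underS r \<alpha>"
    and M: "\<And>\<alpha>. \<alpha> \<in> S \<Longrightarrow> M \<alpha> \<subseteq> underS r \<alpha> \<and> |M \<alpha>| =o \<mu>"
  obtains S' where "S' \<subseteq> S" "stationary r S'" "inj_on \<xi> S'" "\<And>\<alpha>. \<alpha> \<in> S' \<Longrightarrow> |M \<alpha> - \<xi> ` S'| =o \<mu>"
proof -
  note w = regular_uncountableD(3)[OF r]
  have SF: "S \<subseteq> Field r" using S by (simp add: stationary_def)
  \<comment> \<open>On points of \<open>S\<close> closed under \<open>\<xi>\<close> the map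
    \<open>\<xi>\<close> is strictly increasing: smaller points have their images below the larger
    point, whose own image is not below it.\<close>
  define C where "C = {\<delta>\<in>Field r. underS r \<delta> \<noteq> {} \<and>
    (\<forall>\<alpha>\<in>underS r \<delta>. (if \<alpha> \<in> S then \<xi> \<alpha> else \<alpha>) \<in> underS r \<delta>)}"
  have C: "club r C" unfolding C_def by (rule club_closed_under[OF r]) (use \<xi> in auto)
  define S1 where "S1 = S \<inter> C"
  have S1: "stationary r S1" "S1 \<subseteq> S" unfolding S1_def using stationary_Int_club[OF r S C] by auto
  have up: "\<xi> \<alpha> \<in> underS r \<beta>" if "\<alpha> \<in> S1" "\<beta> \<in> S1" "\<alpha> \<in> underS r \<beta>" for \<alpha> \<beta>
    using that by (force simp: S1_def C_def)
  have le: "(\<alpha>, \<xi> \<alpha>) \<in> r" if "\<alpha> \<in> S" for \<alpha>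
    using not_in_underS_iff[OF w] \<xi>[OF that] that SF by blast
  have inj: "inj_on \<xi> S1"
  proof (rule inj_onI)
    fix \<alpha> \<beta> assume ab: "\<alpha> \<in> S1" "\<beta> \<in> S1" "\<xi> \<alpha> = \<xi> \<beta>"
    have "\<alpha> \<notin> underS r \<beta>" "\<beta> \<notin> underS r \<alpha>"
      using up ab \<xi> S1(2) by (metis subsetD)+
    then show "\<alpha> = \<beta>" using well_order_onD(5)[OF w, of \<alpha> \<beta>] ab SF S1(2) by (auto simp: underS_def)
  qed
  have "wf (r - Id)" using w by (simp add: well_order_on_def)
  then obtain T where T: "\<And>\<alpha>. \<alpha> \<in> T \<longleftrightarrow> \<alpha> \<in> S1 \<and> |M \<alpha> \<inter> \<xi> ` (T \<inter> {y. (y, \<alpha>) \<in> r - Id})| <o \<mu>"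
    using wf_recursive_set[of "r - Id" "\<lambda>\<alpha> X. \<alpha> \<in> S1 \<and> |M \<alpha> \<inter> \<xi> ` X| <o \<mu>"] by blast
  have TS: "T \<subseteq> S1" using T by blast
  \<comment> \<open>Restricting to earlier elements of \<open>T\<close> loses nothing: if
    \<open>\<xi> \<beta>\<close> lies in \<open>M \<alpha>\<close>, then
    \<open>\<beta> \<le> \<xi> \<beta> < \<alpha>\<close>.\<close>
  have below: "M \<alpha> \<inter> \<xi> ` (T \<inter> {y. (y, \<alpha>) \<in> r - Id}) = M \<alpha> \<inter> \<xi> ` T" if \<alpha>: "\<alpha> \<in> S1" for \<alpha>
  proof -
    have "(\<beta>, \<alpha>) \<in> r - Id" if "\<beta> \<in> T" "\<xi> \<beta> \<in> M \<alpha>" for \<beta>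
    proof -
      have "\<xi> \<beta> \<in> underS r \<alpha>" using M \<alpha> S1(2) that by blast
      then have "\<beta> \<in> underS r \<alpha>" using underS_trans2[OF w le] that TS S1(2) by blast
      then show ?thesis by (auto simp: underS_def)
    qed
    then show ?thesis by blast
  qed
  have "stationary r (T \<union> (S1 - T))" using S1(1) TS by (simp add: Un_absorb1)
  from stationary_Un[OF r this] show thesis
  proof
    assume st: "stationary r T"
    have "|M \<alpha> - \<xi> ` T| =o \<mu>" if \<alpha>: "\<alpha> \<in> T" for \<alpha>
    proof -
      have small: "|M \<alpha> \<inter> \<xi> ` T| <o \<mu>" using T[of \<alpha>] below[of \<alpha>] \<alpha> TS by auto
      have Ma: "|M \<alpha>| =o \<mu>" using M \<alpha> TS S1(2) by blast
      have "\<not> |M \<alpha> - \<xi> ` T| <o \<mu>"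
      proof
        assume "|M \<alpha> - \<xi> ` T| <o \<mu>"
        from Un_Cinfinite_bound_strict[OF this small \<mu>]
        have "|M \<alpha>| <o \<mu>" by (simp add: Un_Diff_Int)
        then show False using Ma not_ordLess_ordIso by blast
      qed
      then have "\<mu> \<le>o |M \<alpha> - \<xi> ` T|"
        using \<mu> by (simp add: not_card_of_ordLess)
      moreover have "|M \<alpha> - \<xi> ` T| \<le>o \<mu>"
        by (rule ordLeq_ordIso_trans[OF card_of_mono1 Ma]) auto
      ultimately show ?thesis by (simp add: ordIso_iff_ordLeq)
    qed
    then show thesis using that[of T] st TS S1(2) inj inj_on_subset by blast
  next
    assume st: "stationary r (S1 - T)"
    \<comment> \<open>For \<open>\<alpha>\<close> outside \<open>T\<close>, at least
      \<open>\<mu>\<close> points of \<open>M \<alpha>\<close> lie in the \<open>\<xi>\<close>-image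
      of \<open>T\<close>, which is disjoint from that of \<open>S1 - T\<close> by
      injectivity.\<close>
    have "|M \<alpha> - \<xi> ` (S1 - T)| =o \<mu>" if \<alpha>: "\<alpha> \<in> S1 - T" for \<alpha>
    proof -
      have Ma: "|M \<alpha>| =o \<mu>" using M \<alpha> S1(2) by blast
      have "\<not> |M \<alpha> \<inter> \<xi> ` T| <o \<mu>" using T[of \<alpha>] below[of \<alpha>] \<alpha> by auto
      then have "\<mu> \<le>o |M \<alpha> \<inter> \<xi> ` T|"
        using \<mu> by (simp add: not_card_of_ordLess)
      also have "|M \<alpha> \<inter> \<xi> ` T| \<le>o |M \<alpha> - \<xi> ` (S1 - T)|"
        using inj TS by (intro card_of_mono1) (auto dest: inj_onD)
      finally have "\<mu> \<le>o |M \<alpha> - \<xi> ` (S1 - T)|" .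
      moreover have "|M \<alpha> - \<xi> ` (S1 - T)| \<le>o \<mu>"
        by (rule ordLeq_ordIso_trans[OF card_of_mono1 Ma]) auto
      ultimately show ?thesis by (simp add: ordIso_iff_ordLeq)
    qed
    then show thesis using that[of "S1 - T"] st S1(2) inj inj_on_subset by blast
  qed
qed

section \<open>Graphs of regular cardinality\<close>

text \<open>Each vertex \<open>x\<close> is assigned the least point \<open>k x\<close> above it in
  a club avoiding the bad set. The resulting blocks are bounded, hence small, and all earlier blocks
  lie below a club point \<open>\<delta> \<le> x\<close>, below which \<open>x\<close> has fewer
  than \<open>\<mu>\<close> neighbors.\<close>

lemma well_orderable_below_if_not_stationary:
  fixes V :: "'a set" and \<mu> :: "'m rel"
  defines "r \<equiv> |V|"
  assumes r: "regular_uncountable r" and \<mu>: "Cinfinite \<mu>"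
    and small: "\<And>W. W \<subseteq> V \<Longrightarrow> |W| <o r \<Longrightarrow> well_orderable_below W E \<mu>"
    and nst: "\<not> stationary r {\<alpha>\<in>V. \<exists>x\<in>V. x \<notin> underS r \<alpha> \<and> \<mu> \<le>o |nbrs E x \<inter> underS r \<alpha>|}"
  shows "well_orderable_below V E \<mu>"
proof -
  have F: "Field r = V" by (simp add: r_def Field_card_of)
  have w: "well_order_on V r" using regular_uncountableD(3)[OF r] F by simp
  have co: "Card_order r" using r by (simp add: regular_uncountable_def)
  obtain C where C: "club r C"
    "\<And>\<alpha> x. \<alpha> \<in> C \<Longrightarrow> x \<in> V \<Longrightarrow> x \<notin> underS r \<alpha> \<Longrightarrow> \<not> \<mu> \<le>o |nbrs E x \<inter> underS r \<alpha>|"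
  proof -
    obtain C where "club r C" "{\<alpha>\<in>V. \<exists>x\<in>V. x \<notin> underS r \<alpha> \<and> \<mu> \<le>o |nbrs E x \<inter> underS r \<alpha>|} \<inter> C = {}"
      using nst F unfolding stationary_def by auto
    then show ?thesis using that[of C] F unfolding club_def by blast
  qed
  have CV: "C \<subseteq> V" using C(1) F by (simp add: club_def)
  have "\<exists>\<gamma>. \<gamma> \<in> C \<and> x \<in> underS r \<gamma> \<and> (\<forall>c\<in>C. x \<in> underS r c \<longrightarrow> (\<gamma>, c) \<in> r)" if x: "x \<in> V" for x
  proof -
    have "\<exists>c. c \<in> C \<and> c \<in> Field r \<and> x \<in> underS r c" using club_next[OF C(1)] x F by blast
    then have "{c\<in>C. x \<in> underS r c} \<noteq> {}" by blast
    then obtain \<gamma> where "\<gamma> \<in> {c\<in>C. x \<in> underS r c}" "\<And>c. c \<in> {c\<in>C. x \<in> underS r c} \<Longrightarrow> (\<gamma>, c) \<in> r"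
      by (rule well_order_on_least[OF w, of "{c\<in>C. x \<in> underS r c}", rotated]) (use CV in auto)
    then show ?thesis by blast
  qed
  then obtain k where k: "\<And>x. x \<in> V \<Longrightarrow> k x \<in> C \<and> x \<in> underS r (k x) \<and>
      (\<forall>c\<in>C. x \<in> underS r c \<longrightarrow> (k x, c) \<in> r)" by metis
  show ?thesis
  proof (rule well_orderable_below_lex[OF \<mu> w, of V k])
    show "k x \<in> V" if "x \<in> V" for x using k[OF that] CV by blast
    show "well_orderable_below {x\<in>V. k x = i} E \<mu>" if "i \<in> V" for i
    proof (rule small)
      have "{x\<in>V. k x = i} \<subseteq> underS r i" using k by blast
      then show "|{x\<in>V. k x = i}| <o r"
        using that F by (intro ordLeq_ordLess_trans[OF card_of_mono1 card_of_underS[OF co]]) auto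
    qed auto
    fix x assume x: "x \<in> V"
    define P where "P = {y\<in>V. k y \<in> underS r (k x)}"
    have P: "(k y, x) \<in> r" "y \<in> underS r (k y)" "k y \<in> C" if "y \<in> P" for y
    proof -
      have y: "y \<in> V" "k y \<in> underS r (k x)" using that by (auto simp: P_def)
      have "x \<notin> underS r (k y)"
      proof
        assume "x \<in> underS r (k y)"
        then have "(k x, k y) \<in> r" using k[OF x] k[OF y(1)] by blast
        then show False using y(2) well_order_onD(4)[OF w, of "k x" "k y"] by (auto simp: underS_def)
      qed
      then show "(k y, x) \<in> r" using not_in_underS_iff[OF w x] k[OF y(1)] CV by blast
      show "y \<in> underS r (k y)" "k y \<in> C" using k[OF y(1)] by auto
    qed
    have "|nbrs E x \<inter> P| <o \<mu>"
    proof (cases "P = {}")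
      case True
      then show ?thesis by (simp add: card_of_finite_ordLess[OF \<mu>])
    next
      case False
      \<comment> \<open>\<open>\<delta>\<close> is the supremum of the elements of \<open>C\<close> up to \<open>x\<close>.\<close>
      obtain \<delta> where \<delta>: "\<delta> \<in> {z\<in>V. \<forall>c\<in>C. (c, x) \<in> r \<longrightarrow> (c, z) \<in> r}"
        "\<And>z. z \<in> {z\<in>V. \<forall>c\<in>C. (c, x) \<in> r \<longrightarrow> (c, z) \<in> r} \<Longrightarrow> (\<delta>, z) \<in> r"
        by (rule well_order_on_least[OF w, of "{z\<in>V. \<forall>c\<in>C. (c, x) \<in> r \<longrightarrow> (c, z) \<in> r}"])
          (use x in auto)
      have \<delta>x: "(\<delta>, x) \<in> r" using \<delta>(2)[of x] x by blast
      have P\<delta>: "y \<in> underS r \<delta>" if "y \<in> P" for y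
        using underS_trans[OF w] P[OF that] \<delta>(1) by blast
      have "\<delta> \<in> C"
      proof (rule ccontr)
        assume n: "\<delta> \<notin> C"
        have "\<exists>\<gamma>\<in>C \<inter> underS r \<delta>. \<beta> \<in> underS r \<gamma>" if \<beta>: "\<beta> \<in> underS r \<delta>" for \<beta>
        proof -
          have \<beta>V: "\<beta> \<in> V" using well_order_onD(1)[OF w, of \<beta> \<delta>] \<beta> by (auto simp: underS_def)
          have "(\<delta>, \<beta>) \<notin> r" using \<beta> well_order_onD(4)[OF w, of \<beta> \<delta>] by (auto simp: underS_def)
          then obtain c where c: "c \<in> C" "(c, x) \<in> r" "(c, \<beta>) \<notin> r" using \<delta>(2)[of \<beta>] \<beta>V by blast
          then have "(c, \<delta>) \<in> r" "c \<noteq> \<delta>" using \<delta>(1) n by auto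
          moreover have "\<beta> \<in> underS r c" using not_in_underS_iff[OF w \<beta>V, of c] c CV by blast
          ultimately show ?thesis using c by (auto simp: underS_def)
        qed
        moreover have "underS r \<delta> \<noteq> {}" using False P\<delta> by blast
        ultimately show False using C(1) n \<delta>(1) F unfolding club_def by blast
      qed
      moreover have "x \<notin> underS r \<delta>" using not_in_underS_iff[OF w x, of \<delta>] \<delta>x \<delta>(1) by blast
      ultimately have "\<not> \<mu> \<le>o |nbrs E x \<inter> underS r \<delta>|" using C(2) x by blast
      then have "|nbrs E x \<inter> underS r \<delta>| <o \<mu>" using not_card_of_ordLess \<mu> by blast
      moreover have "|nbrs E x \<inter> P| \<le>o |nbrs E x \<inter> underS r \<delta>|"
        using P\<delta> by (intro card_of_mono1) blast
      ultimately show ?thesis by (metis ordLeq_ordLess_trans)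
    qed
    then show "|nbrs E x \<inter> {y\<in>V. k y \<in> underS r (k x)}| <o \<mu>" by (simp add: P_def)
  qed
qed

section \<open>The stationary case: guessing colorings by diamond\<close>

lemma subset_of_card:
  assumes "Card_order \<mu>" "\<mu> \<le>o |A|"
  obtains B where "B \<subseteq> A" "|B| =o \<mu>"
proof -
  obtain f where f: "inj_on f (Field \<mu>)" "f ` Field \<mu> \<subseteq> A"
    using ordIso_ordLeq_trans[OF card_of_Field_ordIso[OF assms(1)] assms(2)]
    by (auto simp: card_of_ordLeq[symmetric])
  have "|Field \<mu>| =o |f ` Field \<mu>|"
    using f(1) inj_on_imp_bij_betw card_of_ordIsoI by blast
  then have "|f ` Field \<mu>| =o \<mu>"
    by (rule ordIso_transitive[OF ordIso_symmetric card_of_Field_ordIso[OF assms(1)]])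
  then show thesis using that f(2) by blast
qed

text \<open>The product of \<open>V\<close> with \<open>Field \<mu>\<close> injects into
  \<open>V\<close>, as \<open>V\<close> is infinite and at least as large as \<open>\<mu>\<close>;
  the images of its rows are the required sets.\<close>

lemma disjoint_sets_of_card:
  fixes V :: "'a set"
  assumes \<mu>: "Cinfinite \<mu>" "\<mu> \<le>o |V|"
  obtains P where "\<And>x. x \<in> V \<Longrightarrow> P x \<subseteq> V \<and> |P x| =o \<mu>"
    "\<And>x y. x \<in> V \<Longrightarrow> y \<in> V \<Longrightarrow> x \<noteq> y \<Longrightarrow> P x \<inter> P y = {}"
proof -
  have inf: "infinite V"
    using cinfinite_mono[OF \<mu>(2)] \<mu>(1) by (simp add: cinfinite_def Field_card_of)
  have "|Field \<mu>| \<le>o |V|"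
    using \<mu> card_of_Field_ordIso ordIso_ordLeq_trans by blast
  then have "|V \<times> Field \<mu>| \<le>o |V|"
    by (intro card_of_Sigma_ordLeq_infinite inf) (auto intro: card_of_mono1)
  then obtain b where b: "inj_on b (V \<times> Field \<mu>)" "b ` (V \<times> Field \<mu>) \<subseteq> V"
    by (auto simp: card_of_ordLeq[symmetric])
  define P where "P x = b ` ({x} \<times> Field \<mu>)" for x
  show thesis
  proof (rule that[of P])
    fix x assume x: "x \<in> V"
    have "bij_betw (\<lambda>i. b (x, i)) (Field \<mu>) (P x)"
      using b(1) x by (auto simp: bij_betw_def P_def inj_on_def)
    then have "|Field \<mu>| =o |P x|" by (rule card_of_ordIsoI)
    from ordIso_transitive[OF ordIso_symmetric[OF this] card_of_Field_ordIso] have "|P x| =o \<mu>"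
      using \<mu>(1) by blast
    then show "P x \<subseteq> V \<and> |P x| =o \<mu>" using b(2) x by (auto simp: P_def)
  next
    fix x y assume "x \<in> V" "y \<in> V" "x \<noteq> y"
    then show "P x \<inter> P y = {}" using b(1) by (auto simp: P_def inj_on_def)
  qed
qed

text \<open>Vertices serve both as ordinals and as colors. Non-witnesses have disjoint lists, so the
  set \<open>A\<close> of their colors determines their coloring, and a subset guessed by diamond
  suffices. Where the guess is right, every color in the list of the witness is already taken by a
  neighbor.\<close>

lemma not_list_colorable_if_stationary:
  fixes V :: "'a set" and \<mu> :: "'m rel"
  defines "r \<equiv> |V|"
  assumes r: "regular_uncountable r" and \<mu>: "Cinfinite \<mu>" "\<mu> <o r"
    and diamonds: "\<And>S. stationary r S \<Longrightarrow> diamond r S"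
    and st: "stationary r {\<alpha>\<in>V. \<exists>x\<in>V. x \<notin> underS r \<alpha> \<and> \<mu> \<le>o |nbrs E x \<inter> underS r \<alpha>|}"
  shows "\<not> list_colorable V E (UNIV :: 'a set) \<mu>"
proof
  assume lc: "list_colorable V E (UNIV :: 'a set) \<mu>"
  have F: "Field r = V" by (simp add: r_def Field_card_of)
  note rD = regular_uncountableD[OF r]
  define S0 where "S0 = {\<alpha>\<in>V. \<exists>x\<in>V. x \<notin> underS r \<alpha> \<and> \<mu> \<le>o |nbrs E x \<inter> underS r \<alpha>|}"
  have "\<forall>\<alpha>. \<exists>x M. \<alpha> \<in> S0 \<longrightarrow> x \<in> V \<and> x \<notin> underS r \<alpha> \<and> M \<subseteq> nbrs E x \<inter> underS r \<alpha> \<and> |M| =o \<mu>"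
  proof
    fix \<alpha>
    show "\<exists>x M. \<alpha> \<in> S0 \<longrightarrow> x \<in> V \<and> x \<notin> underS r \<alpha> \<and> M \<subseteq> nbrs E x \<inter> underS r \<alpha> \<and> |M| =o \<mu>"
    proof (cases "\<alpha> \<in> S0")
      case True
      then obtain x where x: "x \<in> V" "x \<notin> underS r \<alpha>" "\<mu> \<le>o |nbrs E x \<inter> underS r \<alpha>|"
        by (auto simp: S0_def)
      then obtain M where "M \<subseteq> nbrs E x \<inter> underS r \<alpha>" "|M| =o \<mu>"
        using subset_of_card[OF _ x(3)] \<mu>(1) by blast
      then show ?thesis using x by blast
    qed simp
  qed
  then obtain \<xi> M where \<xi>M: "\<And>\<alpha>. \<alpha> \<in> S0 \<Longrightarrow> \<xi> \<alpha> \<in> V \<and> \<xi> \<alpha> \<notin> underS r \<alpha> \<and>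
      M \<alpha> \<subseteq> nbrs E (\<xi> \<alpha>) \<inter> underS r \<alpha> \<and> |M \<alpha>| =o \<mu>" by metis
  obtain S where S: "S \<subseteq> S0" "stationary r S" "inj_on \<xi> S" "\<And>\<alpha>. \<alpha> \<in> S \<Longrightarrow> |M \<alpha> - \<xi> ` S| =o \<mu>"
    by (rule stationary_separate[OF r st[folded S0_def] \<mu>(1), of \<xi> M]) (use \<xi>M F in auto)
  define N where "N \<alpha> = M \<alpha> - \<xi> ` S" for \<alpha>
  have N: "N \<alpha> \<subseteq> nbrs E (\<xi> \<alpha>) \<inter> underS r \<alpha>" "|N \<alpha>| =o \<mu>" "N \<alpha> \<inter> \<xi> ` S = {}" "N \<alpha> \<subseteq> V"
    if "\<alpha> \<in> S" for \<alpha>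
  proof -
    have "\<alpha> \<in> S0" using that S(1) by blast
    note \<xi>M[OF this]
    then show "N \<alpha> \<subseteq> nbrs E (\<xi> \<alpha>) \<inter> underS r \<alpha>" unfolding N_def by blast
    then show "N \<alpha> \<subseteq> V" using Order_Relation.underS_Field[of r \<alpha>] F by blast
    show "|N \<alpha>| =o \<mu>" "N \<alpha> \<inter> \<xi> ` S = {}" using S(4) that unfolding N_def by auto
  qed
  have "\<mu> \<le>o |V|" using \<mu>(2) ordLess_imp_ordLeq by (auto simp: r_def)
  then obtain P where P: "\<And>x. x \<in> V \<Longrightarrow> P x \<subseteq> V \<and> |P x| =o \<mu>"
    "\<And>x y. x \<in> V \<Longrightarrow> y \<in> V \<Longrightarrow> x \<noteq> y \<Longrightarrow> P x \<inter> P y = {}"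
    using disjoint_sets_of_card[OF \<mu>(1)] by blast
  obtain d where d: "\<And>A. A \<subseteq> V \<Longrightarrow> stationary r {\<alpha>\<in>S. d \<alpha> = A \<inter> underS r \<alpha>}"
    using diamonds[OF S(2)] F unfolding diamond_def by auto
  \<comment> \<open>These are the guessed colors that belong to lists of vertices in
    \<open>N \<alpha>\<close>. The witness uses them if there are exactly \<open>\<mu>\<close> of
    them and falls back on \<open>P x\<close> otherwise.\<close>
  define L where "L \<alpha> = d \<alpha> \<inter> \<Union>(P ` N \<alpha>)" for \<alpha>
  define Fl where "Fl x = (if x \<in> \<xi> ` S \<and> |L (the_inv_into S \<xi> x)| =o \<mu>
    then L (the_inv_into S \<xi> x) else P x)" for x
  have "card_assignment V (UNIV :: 'a set) \<mu> Fl"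
    using P(1) by (auto simp: card_assignment_def Fl_def)
  then obtain f where f: "good_coloring V E f" "\<And>x. x \<in> V \<Longrightarrow> f x \<in> Fl x"
    using lc unfolding list_colorable_def by blast
  have fP: "f x \<in> P x" if "x \<in> V" "x \<notin> \<xi> ` S" for x
    using f(2)[OF that(1)] that(2) by (simp add: Fl_def)
  define A where "A = f ` (V - \<xi> ` S)"
  have AV: "A \<subseteq> V" using fP P(1) by (auto simp: A_def)
  \<comment> \<open>At a point \<open>\<alpha>\<close> closed under these bounds, the lists of all
    vertices in \<open>N \<alpha>\<close> lie below \<open>\<alpha>\<close>, so their colors survive
    in the initial segment of \<open>A\<close> guessed there.\<close>
  have "\<exists>b. b \<in> V \<and> P y \<subseteq> underS r b" if y: "y \<in> V" for y
  proof -
    have "|P y| <o r" using P(1)[OF y] \<mu>(2) ordIso_ordLess_trans by blast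
    then show ?thesis
      using regularCard_bounded[OF rD(1,2), of "P y"] P(1)[OF y] F by blast
  qed
  then obtain h where h: "\<And>y. y \<in> V \<Longrightarrow> h y \<in> V \<and> P y \<subseteq> underS r (h y)" by metis
  define C where "C = {\<delta>\<in>Field r. underS r \<delta> \<noteq> {} \<and> (\<forall>\<alpha>\<in>underS r \<delta>. h \<alpha> \<in> underS r \<delta>)}"
  have "club r C" unfolding C_def by (rule club_closed_under[OF r]) (use h F in auto)
  then obtain \<alpha> where \<alpha>: "\<alpha> \<in> S" "d \<alpha> = A \<inter> underS r \<alpha>" "\<alpha> \<in> C"
    using d[OF AV] unfolding stationary_def by blast
  have PN: "P y \<subseteq> underS r \<alpha>" if "y \<in> N \<alpha>" for y
  proof
    fix c assume "c \<in> P y"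
    then have "c \<in> underS r (h y)" "h y \<in> underS r \<alpha>"
      using h N[OF \<alpha>(1)] that \<alpha>(3) by (auto simp: C_def)
    then show "c \<in> underS r \<alpha>" using underS_trans[OF rD(3)] by blast
  qed
  have L: "L \<alpha> = f ` N \<alpha>"
  proof (intro set_eqI iffI)
    fix c assume "c \<in> L \<alpha>"
    then obtain y z where yz: "y \<in> N \<alpha>" "c \<in> P y" "c = f z" "z \<in> V" "z \<notin> \<xi> ` S"
      by (auto simp: L_def \<alpha>(2) A_def)
    then have "z = y" using fP[of z] P(2)[of z y] N(4)[OF \<alpha>(1)] by blast
    then show "c \<in> f ` N \<alpha>" using yz by blast
  next
    fix c assume "c \<in> f ` N \<alpha>"
    then obtain y where y: "y \<in> N \<alpha>" "c = f y" by blast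
    then have "y \<in> V" "y \<notin> \<xi> ` S" using N(3,4)[OF \<alpha>(1)] by auto
    then show "c \<in> L \<alpha>" using y fP[of y] PN[OF y(1)] by (auto simp: L_def \<alpha>(2) A_def)
  qed
  have "inj_on f (N \<alpha>)"
  proof (rule inj_onI)
    fix x y assume xy: "x \<in> N \<alpha>" "y \<in> N \<alpha>" "f x = f y"
    then have "x \<in> V" "y \<in> V" "x \<notin> \<xi> ` S" "y \<notin> \<xi> ` S" using N(3,4)[OF \<alpha>(1)] by auto
    then show "x = y" using fP[of x] fP[of y] P(2)[of x y] xy(3) by auto
  qed
  then have "bij_betw f (N \<alpha>) (L \<alpha>)" using L inj_on_imp_bij_betw by simp
  then have "|L \<alpha>| =o \<mu>"
    by (rule ordIso_transitive[OF ordIso_symmetric[OF card_of_ordIsoI] N(2)[OF \<alpha>(1)]])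
  moreover have "the_inv_into S \<xi> (\<xi> \<alpha>) = \<alpha>" using the_inv_into_f_f[OF S(3) \<alpha>(1)] .
  ultimately have "Fl (\<xi> \<alpha>) = L \<alpha>" using \<alpha>(1) by (simp add: Fl_def)
  moreover have \<xi>V: "\<xi> \<alpha> \<in> V" using \<xi>M S(1) \<alpha>(1) by blast
  ultimately have "f (\<xi> \<alpha>) \<in> f ` N \<alpha>" using f(2) L by metis
  then obtain y where y: "y \<in> N \<alpha>" "f (\<xi> \<alpha>) = f y" by blast
  then have "{y, \<xi> \<alpha>} \<in> E" "y \<in> V" using N[OF \<alpha>(1)] by (auto simp: nbrs_def)
  then show False using f(1) \<xi>V y(2) unfolding good_coloring_def by metis
qed

section \<open>Graphs of singular cardinality\<close>

text \<open>Successors of infinite cardinals are regular, so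
  \<open>cardSuc \<kappa> \<le>o r\<close> cannot be an equality.\<close>

lemma cardSuc_ordLess_if_singular:
  assumes "Card_order r" "\<not> regularCard r" "Cinfinite \<kappa>" "\<kappa> <o r"
  shows "cardSuc \<kappa> <o r"
proof -
  have "cardSuc \<kappa> \<le>o r" using assms by (intro cardSuc_least) auto
  moreover have "\<not> cardSuc \<kappa> =o r"
    using regularCard_ordIso[of "cardSuc \<kappa>" r] Cinfinite_cardSuc regularCard_cardSuc assms by blast
  ultimately show ?thesis by (simp add: ordLeq_iff_ordLess_or_ordIso)
qed

definition many_nbrs :: "'a set \<Rightarrow> 'a set set \<Rightarrow> 'm rel \<Rightarrow> 'a set \<Rightarrow> 'a set" where
  "many_nbrs V E \<mu> B = {x\<in>V. \<mu> \<le>o |nbrs E x \<inter> B|}"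

lemma many_nbrs_mono: "B \<subseteq> B' \<Longrightarrow> many_nbrs V E \<mu> B \<subseteq> many_nbrs V E \<mu> B'"
proof -
  assume "B \<subseteq> B'"
  then have "|nbrs E x \<inter> B| \<le>o |nbrs E x \<inter> B'|" for x by (intro card_of_mono1) blast
  then show ?thesis unfolding many_nbrs_def using ordLeq_transitive by blast
qed

text \<open>Otherwise take \<open>cardSuc |B|\<close> such vertices as \<open>W\<close> and order
  the union of \<open>B\<close> and \<open>W\<close> well. A vertex of \<open>W\<close> outside
  \<open>B\<close> has at least \<open>\<mu>\<close> neighbors in \<open>B\<close> but fewer than
  \<open>\<mu>\<close> smaller ones, so it is itself a smaller neighbor of some \<open>b\<close> in
  \<open>B\<close>. There are at most \<open>|B|\<close> smaller neighbors of elements of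
  \<open>B\<close>.\<close>

lemma card_many_nbrs:
  assumes \<mu>: "Cinfinite \<mu>" and B: "B \<subseteq> V" "\<mu> \<le>o |B|" "cardSuc |B| <o |V|"
    and small: "\<And>W. W \<subseteq> V \<Longrightarrow> |W| <o |V| \<Longrightarrow> well_orderable_below W E \<mu>"
  shows "|many_nbrs V E \<mu> B| \<le>o |B|"
proof (rule ccontr)
  have cB: "Card_order |B|" by (rule card_of_Card_order)
  assume "\<not> ?thesis"
  then have "|B| <o |many_nbrs V E \<mu> B|"
    using not_ordLeq_iff_ordLess[OF card_of_Well_order card_of_Well_order] by blast
  then have "cardSuc |B| \<le>o |many_nbrs V E \<mu> B|"
    using cardSuc_ordLess_ordLeq[OF cB card_of_Card_order] by blast
  from subset_of_card[OF cardSuc_Card_order[OF cB] this]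
  obtain W where W: "W \<subseteq> many_nbrs V E \<mu> B" "|W| =o cardSuc |B|" .
  have BV: "|B| <o |V|" using cardSuc_greater[OF cB] B(3) by (rule ordLess_transitive)
  have WV: "|W| <o |V|" using W(2) B(3) by (rule ordIso_ordLess_trans)
  have infB: "Cinfinite |B|" using cinfinite_mono[OF B(2)] \<mu> card_of_Card_order by blast
  have infV: "Cinfinite |V|"
    using cinfinite_mono[OF ordLess_imp_ordLeq[OF BV]] infB card_of_Card_order by blast
  have "B \<union> W \<subseteq> V" using B W by (auto simp: many_nbrs_def)
  moreover have "|B \<union> W| <o |V|" by (rule Un_Cinfinite_bound_strict[OF BV WV infV])
  ultimately obtain s where s: "well_order_on (B \<union> W) s"
    "\<And>x. x \<in> B \<union> W \<Longrightarrow> |nbrs E x \<inter> underS s x| <o \<mu>"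
    using small unfolding well_orderable_below_def by blast
  have "W \<subseteq> B \<union> (\<Union>b\<in>B. nbrs E b \<inter> underS s b)"
  proof
    fix x assume x: "x \<in> W"
    show "x \<in> B \<union> (\<Union>b\<in>B. nbrs E b \<inter> underS s b)"
    proof (cases "x \<in> B")
      case False
      have "\<mu> \<le>o |nbrs E x \<inter> B|" using x W(1) by (auto simp: many_nbrs_def)
      with s(2)[of x] x have "|nbrs E x \<inter> underS s x| <o |nbrs E x \<inter> B|"
        by (blast intro: ordLess_ordLeq_trans)
      then have "\<not> nbrs E x \<inter> B \<subseteq> nbrs E x \<inter> underS s x"
        using card_of_mono1 not_ordLess_ordLeq by blast
      then obtain b where b: "b \<in> nbrs E x" "b \<in> B" "b \<notin> underS s x" by blast
      then have "(x, b) \<in> s" using not_in_underS_iff[OF s(1), of b x] x by blast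
      then have "x \<in> nbrs E b \<inter> underS s b"
        using b False by (auto simp: underS_def nbrs_def insert_commute)
      then show ?thesis using b by blast
    qed simp
  qed
  then have "|W| \<le>o |B \<union> (\<Union>b\<in>B. nbrs E b \<inter> underS s b)|" by (rule card_of_mono1)
  also have "|B \<union> (\<Union>b\<in>B. nbrs E b \<inter> underS s b)| \<le>o |B|"
  proof (intro Un_Cinfinite_bound UNION_Cinfinite_bound ballI infB)
    fix b assume "b \<in> B"
    then show "|nbrs E b \<inter> underS s b| \<le>o |B|"
      using s(2)[of b] B(2) ordLess_ordLeq_trans ordLess_imp_ordLeq by blast
  qed (auto intro: card_of_mono1)
  finally have "cardSuc |B| \<le>o |B|" using W(2) ordIso_symmetric ordIso_ordLeq_trans by blast
  then show False using cardSuc_greater[OF cB] not_ordLess_ordLeq by blast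
qed

lemma exists_cover:
  assumes "|A| \<le>o |L|"
  shows "\<exists>e. A \<subseteq> e ` L"
proof (cases "A = {}")
  case False
  from iffD2[OF card_of_ordLeq2[OF this] assms] obtain e where "e ` L = A" ..
  then show ?thesis by blast
qed simp

text \<open>
  For \<open>k\<close> in a small cofinal set \<open>K\<close>, the sets \<open>A n k\<close>, where \<open>n\<close> runs through \<open>\<mu>\<^sup>+\<close>, are increasing
  in \<open>n\<close> and in \<open>k\<close> and have the size of \<open>L k\<close>.  Step \<open>n + 1\<close> adds to \<open>A n i\<close> the vertices with
  many neighbors in it, which makes the union \<open>B i\<close> closed.  It also adds, for every \<open>k\<close>, the part
  of \<open>A n k\<close> enumerated by \<open>L i\<close>, so that \<open>B k\<close> is the union of the earlier \<open>B i\<close> at limits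
  \<open>k\<close> of \<open>K\<close>, where \<open>L k\<close> is the union of the earlier \<open>L i\<close>.
\<close>

lemma well_orderable_below_singular:
  fixes V :: "'a set" and \<mu> :: "'m rel"
  defines "r \<equiv> |V|"
  assumes sing: "\<not> regularCard r" and \<mu>: "Cinfinite \<mu>" "\<mu> <o r"
    and small: "\<And>W. W \<subseteq> V \<Longrightarrow> |W| <o r \<Longrightarrow> well_orderable_below W E \<mu>"
  shows "well_orderable_below V E \<mu>"
proof -
  have F: "Field r = V" and r: "Card_order r"
    unfolding r_def by (rule Field_card_of, rule card_of_Card_order)
  have w: "well_order_on V r" using Card_order_wo[OF r] F by simp
  have infr: "Cinfinite r"
    using cinfinite_mono[OF ordLess_imp_ordLeq[OF \<mu>(2)]] \<mu>(1) r by blast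
  obtain K where K: "K \<subseteq> V" "cofinal K r" "|K| <o r"
  proof -
    obtain K where K: "K \<subseteq> V" "cofinal K r" "\<not> |K| =o r"
      using sing F unfolding regularCard_def by blast
    have "|K| \<le>o r" unfolding r_def by (rule card_of_mono1[OF K(1)])
    then show thesis using that K by (simp add: ordLeq_iff_ordLess_or_ordIso)
  qed
  \<comment> \<open>The length \<open>\<nu>\<close> is regular and above \<open>\<mu>\<close>, so
    that any \<open>\<mu>\<close> points of a union of the increasing chain already appear together
    at one stage.\<close>
  define \<nu> where "\<nu> = cardSuc \<mu>"
  have \<nu>: "Cinfinite \<nu>" "regularCard \<nu>" "\<mu> <o \<nu>" "\<nu> <o r"
    unfolding \<nu>_def using \<mu> Cinfinite_cardSuc regularCard_cardSuc cardSuc_greater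
      cardSuc_ordLess_if_singular[OF r sing] by auto
  have w\<nu>: "well_order_on (Field \<nu>) \<nu>" using Card_order_wo \<nu>(1) by blast
  obtain D0 where D0: "D0 \<subseteq> V" "|D0| =o \<nu>"
    using subset_of_card[of \<nu> V] \<nu>(1,4) ordLess_imp_ordLeq unfolding r_def by blast
  \<comment> \<open>Contained in every \<open>L k\<close>, the set \<open>D\<close> makes
    \<open>L k\<close> large enough to absorb unions over \<open>K\<close> and over the stages of
    the chain.\<close>
  define D where "D = D0 \<union> K"
  have D: "D \<subseteq> V" "|D| <o r" "|K| \<le>o |D|" "\<nu> \<le>o |D|"
  proof -
    show "D \<subseteq> V" using D0 K by (simp add: D_def)
    show "|D| <o r" unfolding D_def
      by (rule Un_Cinfinite_bound_strict[OF ordIso_ordLess_trans[OF D0(2) \<nu>(4)] K(3) infr])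
    show "|K| \<le>o |D|" by (rule card_of_mono1) (simp add: D_def)
    have "|D0| \<le>o |D|" by (rule card_of_mono1) (simp add: D_def)
    then show "\<nu> \<le>o |D|" by (rule ordIso_ordLeq_trans[OF ordIso_symmetric[OF D0(2)]])
  qed
  \<comment> \<open>Collecting the vertices up to elements of \<open>K\<close> before
    \<open>k\<close>, rather than all vertices below \<open>k\<close>, makes \<open>L\<close>
    continuous at limits of \<open>K\<close>.\<close>
  define L where "L k = D \<union> {v\<in>V. \<exists>j\<in>K. j \<in> underS r k \<and> (v, j) \<in> r}" for k
  have LV: "L k \<subseteq> V" and DL: "D \<subseteq> L k" for k using D(1) by (auto simp: L_def)
  have Lmono: "L i \<subseteq> L j" if "(i, j) \<in> r" for i j
    using underS_trans[OF w] that by (auto simp: L_def)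
  have Lr: "|L k| <o r" if "k \<in> K" for k
  proof -
    have "L k \<subseteq> D \<union> underS r k" using underS_trans2[OF w] by (auto simp: L_def)
    then have "|L k| \<le>o |D \<union> underS r k|" by (rule card_of_mono1)
    also have "|D \<union> underS r k| <o r"
      using that K(1) F by (intro Un_Cinfinite_bound_strict D(2) card_of_underS[OF r] infr) auto
    finally show ?thesis .
  qed
  have DLc: "|D| \<le>o |L k|" for k by (rule card_of_mono1[OF DL])
  have KL: "|K| \<le>o |L k|" for k by (rule ordLeq_transitive[OF D(3) DLc])
  have \<nu>L: "\<nu> \<le>o |L k|" for k by (rule ordLeq_transitive[OF D(4) DLc])
  have Linf: "Cinfinite |L k|" for k using cinfinite_mono[OF \<nu>L] \<nu>(1) card_of_Card_order by blast
  \<comment> \<open>A chosen map under which the image of \<open>L k\<close> covers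
    \<open>A\<close>, if \<open>A\<close> is not too large. Its other values are unrestricted, hence
    the intersection with \<open>V\<close> in \<open>step\<close>.\<close>
  define e where "e A k = (SOME e. A \<subseteq> e ` L k)" for A :: "'a set" and k
  have e: "A \<subseteq> e A k ` L k" if "|A| \<le>o |L k|" for A k
    unfolding e_def by (rule someI_ex[OF exists_cover[OF that]])
  define step where "step X i = many_nbrs V E \<mu> (X i) \<union> (\<Union>k\<in>K. e (X k) k ` L i) \<inter> V" for X i
  define A where "A = wfrec (\<nu> - Id) (\<lambda>g n i. L i \<union> (\<Union>m\<in>underS \<nu> n. step (g m) i))"
  have wf: "wf (\<nu> - Id)" using w\<nu> by (simp add: well_order_on_def)
  have A: "A n i = L i \<union> (\<Union>m\<in>underS \<nu> n. step (A m) i)" for n i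
  proof -
    have "A n = (\<lambda>i. L i \<union> (\<Union>m\<in>underS \<nu> n. step (cut A (\<nu> - Id) n m) i))"
      unfolding A_def by (rule wfrec[OF wf])
    also have "\<dots> = (\<lambda>i. L i \<union> (\<Union>m\<in>underS \<nu> n. step (A m) i))"
    proof
      fix i
      have "(\<Union>m\<in>underS \<nu> n. step (cut A (\<nu> - Id) n m) i) = (\<Union>m\<in>underS \<nu> n. step (A m) i)"
        by (rule SUP_cong) (auto simp: cut_def underS_def)
      then show "L i \<union> (\<Union>m\<in>underS \<nu> n. step (cut A (\<nu> - Id) n m) i)
          = L i \<union> (\<Union>m\<in>underS \<nu> n. step (A m) i)" by simp
    qed
    finally show ?thesis by (rule fun_cong)
  qed
  have AV: "A n i \<subseteq> V" for n i
    using LV unfolding A[of n i] step_def many_nbrs_def by blast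
  have LA: "L i \<subseteq> A n i" for n i using A[of n i] by blast
  have stepA: "step (A m) i \<subseteq> A n i" if "m \<in> underS \<nu> n" for m n i using A[of n i] that by blast
  have Acard: "|A n i| \<le>o |L i|" if "n \<in> Field \<nu>" "i \<in> K" for n i
    using wf that
  proof (induction n arbitrary: i rule: wf_induct_rule)
    case (less n)
    have "|underS \<nu> n| <o \<nu>"
      by (rule card_of_underS[OF conjunct2[OF \<nu>(1)] less.prems(1)])
    then have un: "|underS \<nu> n| \<le>o |L i|"
      by (rule ordLess_imp_ordLeq[OF ordLess_ordLeq_trans[OF _ \<nu>L]])
    have "|step (A m) i| \<le>o |L i|" if m: "m \<in> underS \<nu> n" for m
    proof -
      have mF: "m \<in> Field \<nu>" using m Order_Relation.underS_Field by fast
      have Am: "|A m i| \<le>o |L i|" using less.IH[of m i] m mF less.prems(2) by (auto simp: underS_def)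
      have LAm: "|L i| \<le>o |A m i|" by (rule card_of_mono1[OF LA])
      have \<mu>A: "\<mu> \<le>o |A m i|"
        by (rule ordLess_imp_ordLeq[OF ordLess_ordLeq_trans[OF \<nu>(3) ordLeq_transitive[OF \<nu>L LAm]]])
      \<comment> \<open>Singularity of \<open>r\<close> leaves the room for a successor that
        \<open>card_many_nbrs\<close> requires.\<close>
      have "cardSuc |A m i| <o r"
      proof (rule cardSuc_ordLess_if_singular[OF r sing])
        show "Cinfinite |A m i|" using cinfinite_mono[OF \<mu>A] \<mu>(1) card_of_Card_order by blast
        show "|A m i| <o r" by (rule ordLeq_ordLess_trans[OF Am Lr[OF less.prems(2)]])
      qed
      then have "|many_nbrs V E \<mu> (A m i)| \<le>o |A m i|"
        unfolding r_def
        by (intro card_many_nbrs[OF \<mu>(1) AV \<mu>A]) (use small[unfolded r_def] in blast)+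
      then have 1: "|many_nbrs V E \<mu> (A m i)| \<le>o |L i|" using Am by (rule ordLeq_transitive)
      have "|\<Union>k\<in>K. e (A m k) k ` L i| \<le>o |L i|"
        by (intro UNION_Cinfinite_bound KL Linf ballI card_of_image)
      then have "|(\<Union>k\<in>K. e (A m k) k ` L i) \<inter> V| \<le>o |L i|"
        by (rule ordLeq_transitive[OF card_of_mono1[OF Int_lower1]])
      from Un_Cinfinite_bound[OF 1 this Linf] show ?thesis by (simp add: step_def)
    qed
    then show ?case unfolding A[of n i]
      by (intro Un_Cinfinite_bound UNION_Cinfinite_bound Linf un ballI) (auto intro: card_of_mono1)
  qed
  have Amono: "A n i \<subseteq> A n' i" if "(n, n') \<in> \<nu>" for n n' i
    unfolding A[of n i] A[of n' i] using underS_trans[OF w\<nu>] that by blast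
  have Amono': "A n i \<subseteq> A n j" if ij: "(i, j) \<in> r" for n i j
    using wf
  proof (induction n rule: wf_induct_rule)
    case (less n)
    have "step (A m) i \<subseteq> step (A m) j" if "m \<in> underS \<nu> n" for m
    proof -
      have "A m i \<subseteq> A m j" using less that by (auto simp: underS_def)
      then show ?thesis unfolding step_def
        by (intro Un_mono Int_mono UN_mono image_mono many_nbrs_mono Lmono[OF ij] subset_refl)
    qed
    then show ?case unfolding A[of n i] A[of n j] using Lmono[OF ij] by blast
  qed
  define B where "B i = (\<Union>n\<in>Field \<nu>. A n i)" for i
  have next\<nu>: "\<exists>n'\<in>Field \<nu>. n \<in> underS \<nu> n'" if "n \<in> Field \<nu>" for n
    using infinite_Card_order_limit[of \<nu> n] \<nu>(1) that by (auto simp: cinfinite_def underS_def)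
  have stepB: "step (A n) i \<subseteq> B i" if "n \<in> Field \<nu>" for n i
    using next\<nu>[OF that] stepA unfolding B_def by blast
  have Bcard: "|B i| <o r" if "i \<in> K" for i
  proof -
    have "|Field \<nu>| \<le>o |L i|" by (rule ordIso_ordLeq_trans[OF card_of_Field_ordIso[OF conjunct2[OF \<nu>(1)]] \<nu>L])
    then have "|B i| \<le>o |L i|" unfolding B_def
      by (intro UNION_Cinfinite_bound Linf ballI Acard that)
    then show ?thesis using Lr[OF that] by (rule ordLeq_ordLess_trans)
  qed
  have Bmono: "B i \<subseteq> B j" if "(i, j) \<in> r" for i j
    using Amono'[OF that] unfolding B_def by blast
  have closed: "|nbrs E x \<inter> B i| <o \<mu>" if x: "x \<in> V" "x \<notin> B i" for x i
  proof (rule ccontr)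
    assume "\<not> ?thesis"
    then have "\<mu> \<le>o |nbrs E x \<inter> B i|" using not_card_of_ordLess \<mu>(1) by blast
    then obtain M where M: "M \<subseteq> nbrs E x \<inter> B i" "|M| =o \<mu>"
      using subset_of_card \<mu>(1) by blast
    then have "\<forall>y\<in>M. \<exists>n. n \<in> Field \<nu> \<and> y \<in> A n i" unfolding B_def by blast
    then obtain t where t: "\<And>y. y \<in> M \<Longrightarrow> t y \<in> Field \<nu> \<and> y \<in> A (t y) i" by metis
    have "|t ` M| <o \<nu>"
      using ordLeq_ordLess_trans[OF card_of_image ordIso_ordLess_trans[OF M(2) \<nu>(3)]] .
    moreover have "t ` M \<subseteq> Field \<nu>" using t by blast
    ultimately obtain b where b: "b \<in> Field \<nu>" "t ` M \<subseteq> underS \<nu> b"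
      using regularCard_bounded[OF \<nu>(1,2)] by blast
    have "y \<in> A b i" if "y \<in> M" for y
    proof -
      have "(t y, b) \<in> \<nu>" using b(2) that by (auto simp: underS_def)
      then show ?thesis using Amono t[OF that] by blast
    qed
    then have "|M| \<le>o |nbrs E x \<inter> A b i|" using M(1) by (intro card_of_mono1) blast
    then have "x \<in> many_nbrs V E \<mu> (A b i)"
      using x(1) ordIso_ordLeq_trans[OF ordIso_symmetric[OF M(2)]] by (auto simp: many_nbrs_def)
    then show False using stepB[OF b(1), of i] x(2) by (auto simp: step_def)
  qed
  have cover: "{i\<in>K. x \<in> B i} \<noteq> {}" if x: "x \<in> V" for x
  proof -
    obtain j where j: "j \<in> K" "(x, j) \<in> r" using K(2) x F unfolding cofinal_def by blast
    then obtain i where "i \<in> K" "j \<in> underS r i"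
      using K(1,2) F unfolding cofinal_def underS_def by blast
    moreover have "Field \<nu> \<noteq> {}" using \<nu>(1) by (auto simp: cinfinite_def)
    ultimately show ?thesis using j x LA[of i] unfolding B_def L_def by blast
  qed
  have "\<exists>i. i \<in> K \<and> x \<in> B i \<and> (\<forall>j\<in>K. x \<in> B j \<longrightarrow> (i, j) \<in> r)" if x: "x \<in> V" for x
  proof -
    obtain i where "i \<in> {i\<in>K. x \<in> B i}" "\<And>j. j \<in> {i\<in>K. x \<in> B i} \<Longrightarrow> (i, j) \<in> r"
      by (rule well_order_on_least[OF w, of "{i\<in>K. x \<in> B i}"]) (use K(1) cover[OF x] in auto)
    then show ?thesis by blast
  qed
  then obtain k where k: "\<And>x. x \<in> V \<Longrightarrow> k x \<in> K \<and> x \<in> B (k x) \<and> (\<forall>j\<in>K. x \<in> B j \<longrightarrow> (k x, j) \<in> r)"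
    by metis
  have least: "x \<notin> B j" if "x \<in> V" "j \<in> K" "j \<in> underS r (k x)" for x j
  proof
    assume "x \<in> B j"
    then have "(k x, j) \<in> r" using k that by blast
    then show False using that(3) well_order_onD(4)[OF w, of j "k x"] by (auto simp: underS_def)
  qed
  \<comment> \<open>The first \<open>B i\<close> containing \<open>x\<close> never has a limit
    index: \<open>x\<close> is enumerated by some \<open>y\<close> in \<open>L (k x)\<close>, at a
    limit \<open>y\<close> lies in an earlier \<open>L i\<close>, and the next step would put
    \<open>x\<close> into \<open>B i\<close>.\<close>
  have limit: "\<exists>j\<in>K \<inter> underS r (k x). \<forall>i\<in>K \<inter> underS r (k x). (i, j) \<in> r"
    if x: "x \<in> V" and ne: "K \<inter> underS r (k x) \<noteq> {}" for x
  proof (rule ccontr)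
    assume "\<not> ?thesis"
    then have lim: "\<And>j. j \<in> K \<inter> underS r (k x) \<Longrightarrow> \<exists>i\<in>K \<inter> underS r (k x). (i, j) \<notin> r" by blast
    have kx: "k x \<in> K" "x \<in> B (k x)" using k[OF x] by auto
    then obtain n where n: "n \<in> Field \<nu>" "x \<in> A n (k x)" unfolding B_def by blast
    then obtain y where y: "y \<in> L (k x)" "x = e (A n (k x)) (k x) y"
      using e[OF Acard[OF n(1) kx(1)]] by blast
    have "\<exists>i\<in>K \<inter> underS r (k x). y \<in> L i"
    proof (cases "y \<in> D")
      case True then show ?thesis using ne DL by blast
    next
      case False
      then obtain j where j: "y \<in> V" "j \<in> K" "j \<in> underS r (k x)" "(y, j) \<in> r"
        using y(1) by (auto simp: L_def)
      then obtain i where i: "i \<in> K \<inter> underS r (k x)" "(i, j) \<notin> r" using lim by blast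
      then have "j \<in> underS r i" using not_in_underS_iff[OF w, of j i] j K(1) by blast
      then show ?thesis using i j by (auto simp: L_def)
    qed
    then obtain i where i: "i \<in> K" "i \<in> underS r (k x)" "y \<in> L i" by blast
    then have "x \<in> step (A n) i" using y(2) kx(1) x unfolding step_def by blast
    then show False using stepB[OF n(1)] least[OF x i(1,2)] by blast
  qed
  show ?thesis
  proof (rule well_orderable_below_lex[OF \<mu>(1) well_order_on_Restr[OF Card_order_wo[OF r] K(1)[folded F]], of V k])
    show "k x \<in> K" if "x \<in> V" for x using k that by blast
    show "well_orderable_below {x\<in>V. k x = i} E \<mu>" if "i \<in> K" for i
    proof (rule small)
      have "{x\<in>V. k x = i} \<subseteq> B i" using k by blast
      then show "|{x\<in>V. k x = i}| <o r"
        by (rule ordLeq_ordLess_trans[OF card_of_mono1 Bcard[OF that]])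
    qed auto
    fix x assume x: "x \<in> V"
    have sub: "underS (Restr r K) (k x) \<subseteq> K \<inter> underS r (k x)" by (auto simp: underS_def)
    show "|nbrs E x \<inter> {y\<in>V. k y \<in> underS (Restr r K) (k x)}| <o \<mu>"
    proof (cases "K \<inter> underS r (k x) = {}")
      case True
      then have "nbrs E x \<inter> {y\<in>V. k y \<in> underS (Restr r K) (k x)} = {}" using sub by blast
      then show ?thesis by (simp add: card_of_finite_ordLess[OF \<mu>(1)])
    next
      case False
      \<comment> \<open>Here \<open>j\<close> is the immediate predecessor of \<open>k x\<close> in
        \<open>K\<close>. All earlier fibres lie in \<open>B j\<close>, in which \<open>x\<close>,
        being outside it, has few neighbors.\<close>
      from limit[OF x this] obtain j where j: "j \<in> K" "j \<in> underS r (k x)"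
        "\<And>i. i \<in> K \<inter> underS r (k x) \<Longrightarrow> (i, j) \<in> r" by blast
      have "nbrs E x \<inter> {y\<in>V. k y \<in> underS (Restr r K) (k x)} \<subseteq> nbrs E x \<inter> B j"
        using sub j(3) k Bmono by blast
      then show ?thesis
        by (rule ordLeq_ordLess_trans[OF card_of_mono1 closed[OF x least[OF x j(1,2)]]])
    qed
  qed
qed

section \<open>List-chromatic number and coloring number\<close>

lemma list_colorable_subset:
  assumes lc: "list_colorable V E C \<kappa>" and W: "W \<subseteq> V"
  shows "list_colorable W E C \<kappa>"
  unfolding list_colorable_def
proof (intro allI impI)
  fix F assume F: "card_assignment W C \<kappa> F"
  show "\<exists>f. good_coloring W E f \<and> (\<forall>x\<in>W. f x \<in> F x)"
  proof (cases "W = {}")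
    case False
    then obtain w where w: "w \<in> W" by blast
    \<comment> \<open>Outside \<open>W\<close> any list of the right size will do, and
      \<open>F w\<close> is one.\<close>
    have "card_assignment V C \<kappa> (\<lambda>x. if x \<in> W then F x else F w)"
      using F w by (simp add: card_assignment_def)
    then obtain f where f: "good_coloring V E f" "\<forall>x\<in>V. f x \<in> (if x \<in> W then F x else F w)"
      using lc unfolding list_colorable_def by blast
    have "good_coloring W E f" using f(1) W unfolding good_coloring_def by blast
    moreover have "\<forall>x\<in>W. f x \<in> F x" using f(2) W by (metis subsetD)
    ultimately show ?thesis by blast
  qed (simp add: good_coloring_def)
qed

text \<open>The induction is on \<open>|V|\<close>, and list-colorability passes to subsets. Beyond
  \<open>|V| \<le>o \<mu>\<close> the cardinal \<open>|V|\<close> is singular or regular; in the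
  regular case list-colorability rules out stationarity of the bad set.\<close>

lemma well_orderable_below_if_list_colorable:
  fixes V :: "'a set" and \<mu> :: "'m rel"
  assumes diamonds: "\<And>(\<kappa> :: 'a rel) S. regular_uncountable \<kappa> \<Longrightarrow> stationary \<kappa> S \<Longrightarrow> diamond \<kappa> S"
    and \<mu>: "Cinfinite \<mu>" and lc: "list_colorable V E (UNIV :: 'a set) \<mu>"
  shows "well_orderable_below V E \<mu>"
proof -
  have "well_orderable_below V E \<mu>" if "r = |V|" "list_colorable V E (UNIV :: 'a set) \<mu>" for r and V :: "'a set"
    using wf_ordLess that
  proof (induction r arbitrary: V rule: wf_induct_rule)
    case (less r V)
    note r = less.prems(1) and lc = less.prems(2)
    have small: "well_orderable_below W E \<mu>" if "W \<subseteq> V" "|W| <o |V|" for W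
      using less.IH[of "|W|" W] that(2) list_colorable_subset[OF lc that(1)] r by blast
    show ?case
    proof (cases "|V| \<le>o \<mu>")
      case True
      then show ?thesis by (rule well_orderable_below_card)
    next
      case False
      then have \<mu>V: "\<mu> <o |V|"
        using not_ordLeq_iff_ordLess[OF _ card_of_Well_order, of \<mu> V] \<mu> by (simp add: card_order_on_def)
      show ?thesis
      proof (cases "regularCard |V|")
        case False
        then show ?thesis by (rule well_orderable_below_singular[OF _ \<mu> \<mu>V small])
      next
        case True
        have "natLeq <o |V|"
          using natLeq_ordLeq_cinfinite[OF \<mu>] \<mu>V by (rule ordLeq_ordLess_trans)
        with True have ru: "regular_uncountable |V|"
          by (simp add: regular_uncountable_def Field_card_of card_of_card_order_on)
        show ?thesis
          using well_orderable_below_if_not_stationary[OF ru \<mu> small]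
            not_list_colorable_if_stationary[OF ru \<mu> \<mu>V diamonds[OF ru]] lc by blast
      qed
    qed
  qed
  then show ?thesis using lc by blast
qed

lemma choosable_if_list_colorable:
  fixes V :: "'a set"
  assumes \<kappa>: "Card_order \<kappa>" "finite (Field \<kappa>)" and lc: "list_colorable V E (UNIV :: nat set) \<kappa>"
  shows "choosable V E (card (Field \<kappa>))"
  unfolding choosable_def
proof (intro allI impI)
  fix F :: "'a \<Rightarrow> nat set" assume F: "\<forall>x\<in>V. finite (F x) \<and> card (F x) = card (Field \<kappa>)"
  have "|F x| =o \<kappa>" if x: "x \<in> V" for x
  proof -
    obtain h where "bij_betw h (F x) (Field \<kappa>)"
      using finite_same_card_bij[of "F x" "Field \<kappa>"] F x \<kappa>(2) by blast
    then show ?thesis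
      by (rule ordIso_transitive[OF card_of_ordIsoI card_of_Field_ordIso[OF \<kappa>(1)]])
  qed
  then have "card_assignment V (UNIV :: nat set) \<kappa> F" by (simp add: card_assignment_def)
  then show "\<exists>f. good_coloring V E f \<and> (\<forall>x\<in>V. f x \<in> F x)"
    using lc unfolding list_colorable_def by blast
qed

text \<open>Choosability gives an expansion constant \<open>D\<close>, and the well-ordering built
  from it bounds the coloring number by \<open>4 * D + 1\<close>.\<close>

lemma not_cinfinite_coloring_number_if_choosable:
  assumes g: "graph V E" and ch: "choosable V E s"
  shows "\<not> cinfinite (coloring_number V E)"
proof
  assume inf: "cinfinite (coloring_number V E)"
  obtain D where D: "\<And>A B. \<lbrakk>finite A; finite B; A \<subseteq> V; B \<subseteq> V; A \<inter> B = {}; A \<noteq> {};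
    \<And>a. a \<in> A \<Longrightarrow> D \<le> card (nbrs E a \<inter> B)\<rbrakk> \<Longrightarrow> card A < card B"
    using choosable_expansion[OF ch] by blast
  have irr: "x \<notin> nbrs E x" for x using g by (auto simp: graph_def nbrs_def nsets_def)
  obtain r where r: "well_order_on V r"
    "\<And>x. x \<in> V \<Longrightarrow> finite (nbrs E x \<inter> underS r x) \<and> card (nbrs E x \<inter> underS r x) < 4 * D + 1"
    using well_order_small_degree[OF irr D] by blast
  define \<kappa> where "\<kappa> = |{..<4 * D + 1}|"
  have "|nbrs E x \<inter> underS r x| <o \<kappa>" if x: "x \<in> V" for x
  proof (rule ccontr)
    assume "\<not> ?thesis"
    then have "|{..<4 * D + 1}| \<le>o |nbrs E x \<inter> underS r x|"
      unfolding \<kappa>_def by (rule not_card_of_ordLess[OF card_of_Card_order])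
    then obtain h where "inj_on h {..<4 * D + 1}" "h ` {..<4 * D + 1} \<subseteq> nbrs E x \<inter> underS r x"
      unfolding card_of_ordLeq[symmetric] by blast
    then have "card {..<4 * D + 1} \<le> card (nbrs E x \<inter> underS r x)"
      using r(2)[OF x] card_inj_on_le by blast
    then show False using r(2)[OF x] by simp
  qed
  then have "well_orderable_below V E \<kappa>" using r(1) unfolding well_orderable_below_def by blast
  then have "coloring_number V E \<le>o \<kappa>"
    by (rule coloring_number(3)[rotated]) (simp add: \<kappa>_def card_of_card_order_on Field_card_of)
  then have "cinfinite \<kappa>" using inf by (rule cinfinite_mono)
  then show False by (simp add: cinfinite_def \<kappa>_def Field_card_of)
qed

theorem theorem1p2:
  fixes V :: "'a set" and E :: "'a set set"
  assumes diamonds: "\<And>(\<kappa> :: 'a rel) S. regular_uncountable \<kappa> \<Longrightarrow> stationary \<kappa> S \<Longrightarrow> diamond \<kappa> S"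
    and "graph V E"
    and "cinfinite (coloring_number V E)"
  shows "coloring_number V E =o list_chromatic_number V E"
proof -
  let ?l = "list_chromatic_number V E"
  note g = assms(2)
  note lcn = list_chromatic_number[OF g]
  have "?l \<le>o coloring_number V E"
    by (rule lcn(3)[OF coloring_number(1)
          list_colorable_if_well_orderable_below[OF g coloring_number(2)]])
  moreover have "coloring_number V E \<le>o ?l"
  proof (rule coloring_number(3)[OF lcn(1)], rule well_orderable_below_if_list_colorable[OF diamonds])
    show "Cinfinite ?l"
    proof (rule ccontr)
      assume "\<not> Cinfinite ?l"
      then have "finite (Field ?l)" using lcn(1) by (simp add: cinfinite_def)
      \<comment> \<open>The fact \<open>lcn(2)\<close> allows any supply of colors: natural numbers
        here, where lists are counted, and vertices below, where diamond guesses sets of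
        colors.\<close>
      from choosable_if_list_colorable[OF lcn(1) this lcn(2)]
      show False using not_cinfinite_coloring_number_if_choosable[OF g] assms(3) by blast
    qed
    show "list_colorable V E (UNIV :: 'a set) ?l" by (rule lcn(2))
  qed
  ultimately show ?thesis by (simp add: ordIso_iff_ordLeq)
qed

end
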